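(* Fix integers $d\ge1$, $k\ge2$, and $\ell\ge2$. There are constants $\varepsilon=\varepsilon(d,k,\ell)>0$ and $N_0=N_0(d,k,\ell)$ with the following property. Let $C\subset\mathbb{R}^2$ be an irreducible real algebraic curve of degree at most $d$, and let $A\subset\mathbb{R}^2$ be finite with no $k$ collinear points. Put $X=A\cap C$ and $N=|X|$. If \[ N\ge N_0, \qquad |A\setminus C|\le \varepsilon N, \] then $A$ contains $\ell$ mutually visible points.
   Context: For $p,q\in\mathbb{R}^2$, $(pq)^\circ$ is the open segment joining them. Two points $p,q$ of a finite set $A\subset\mathbb{R}^2$ are visible in $A$ if $(pq)^\circ$ contains no point of $A$ (blockers may be any points of $A$, on or off $C$); a set of points of $A$ is mutually visible if every two of them are visible in $A$. *)

theory Defs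
  imports "HOL-Analysis.Analysis" "HOL-Computational_Algebra.Computational_Algebra"
begin

text \<open>
  The type \<^typ>\<open>real poly poly\<close> plays the role of the polynomial ring \<open>\<real>[x,y]\<close>, read as
  \<open>\<real>[x][y]\<close>: the coefficient of \<open>x\<^sup>j y\<^sup>i\<close> in \<open>f\<close> is \<open>coeff (coeff f i) j\<close>.
\<close>

definition eval2 :: "real poly poly \<Rightarrow> real ^ 2 \<Rightarrow> real" where
  "eval2 f p = poly (poly f [:p $ 2:]) (p $ 1)"

text \<open>
  Vanishing coefficients \<open>coeff f i\<close> do not affect the maximum: they contribute \<open>i \<le> degree f\<close>,
  which is dominated by the contribution of the leading coefficient.
\<close>

definition total_degree :: "real poly poly \<Rightarrow> nat" where
  "total_degree f = Max ((\<lambda>i. i + degree (coeff f i)) ` {..degree f})"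

lemma total_degree_le_iff:
  "total_degree f \<le> d \<longleftrightarrow> (\<forall>i j. coeff (coeff f i) j \<noteq> 0 \<longrightarrow> i + j \<le> d)"
proof
  assume "total_degree f \<le> d"
  then have le: "i + degree (coeff f i) \<le> d" if "i \<le> degree f" for i
    using that by (simp add: total_degree_def)
  show "\<forall>i j. coeff (coeff f i) j \<noteq> 0 \<longrightarrow> i + j \<le> d"
  proof (intro allI impI)
    fix i j
    assume nz: "coeff (coeff f i) j \<noteq> 0"
    then have "coeff f i \<noteq> 0" by auto
    then have "i \<le> degree f" by (rule le_degree)
    with le[of i] le_degree[OF nz] show "i + j \<le> d" by linarith
  qed
next
  assume *: "\<forall>i j. coeff (coeff f i) j \<noteq> 0 \<longrightarrow> i + j \<le> d"
  have nz: "i + degree (coeff f i) \<le> d" if "coeff f i \<noteq> 0" for i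
    using * that leading_coeff_neq_0 by blast
  have "i + degree (coeff f i) \<le> d" if "i \<le> degree f" for i
  proof (cases "coeff f i = 0")
    case True
    show ?thesis
    proof (cases "f = 0")
      case True
      with that show ?thesis by simp
    next
      case False
      then have "coeff f (degree f) \<noteq> 0" by simp
      from nz[OF this] True that show ?thesis by simp
    qed
  qed (rule nz)
  then show "total_degree f \<le> d" by (simp add: total_degree_def)
qed

text \<open>
  Irreducibility is over \<open>\<real>\<close>; it excludes the constants, which are zero or units of \<open>\<real>[x,y]\<close>.
\<close>

definition irreducible_curve_deg_le :: "nat \<Rightarrow> (real ^ 2) set \<Rightarrow> bool" where
  "irreducible_curve_deg_le d C \<longleftrightarrow>
     (\<exists>f. irreducible f \<and> total_degree f \<le> d \<and> C = {p. eval2 f p = 0})"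

definition no_k_collinear :: "nat \<Rightarrow> (real ^ 2) set \<Rightarrow> bool" where
  "no_k_collinear k A \<longleftrightarrow> \<not> (\<exists>S \<subseteq> A. card S = k \<and> collinear S)"

definition visible_in :: "(real ^ 2) set \<Rightarrow> real ^ 2 \<Rightarrow> real ^ 2 \<Rightarrow> bool" where
  "visible_in A p q \<longleftrightarrow> open_segment p q \<inter> A = {}"

definition mutually_visible :: "(real ^ 2) set \<Rightarrow> (real ^ 2) set \<Rightarrow> bool" where
  "mutually_visible A S \<longleftrightarrow> S \<subseteq> A \<and> pairwise (visible_in A) S"

end

theory Submission
  imports Defs "HOL-Computational_Algebra.Field_as_Ring"
begin

text \<open>
  Let \<open>p\<^sub>0, \<dots>, p\<^sub>m\<^sub>-\<^sub>1\<close> be the vertices of a convex chain. The chords \<open>p\<^sub>a p\<^sub>b\<close> through a fixed further point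
  cross pairwise, so \<open>r\<close> such chords all satisfy \<open>b - a \<ge> r\<close>: one point blocks pairs of total
  weight \<open>\<Sum> 1 / (b - a) \<le> 1\<close>. If every arithmetic progression \<open>i, i + g, \<dots>, i + (l - 1) g\<close> of
  indices contained a blocked pair, then weighting progressions by \<open>1 / g\<close> would give
  \<open>m log m \<lesssim> l\<^sup>3 |A|\<close>. Hence any set with a positive proportion of its points on a convex
  chain contains \<open>l\<close> mutually visible points once it is large.

  An irreducible curve \<open>f = 0\<close> supplies the chain. Eliminating \<open>y\<close> gives a nonzero \<open>P(x)\<close> of degree
  bounded in terms of \<open>d\<close> such that, where \<open>P \<noteq> 0\<close>, the curve is a disjoint union of at most \<open>d\<close>
  graphs, and either all of them are affine or their second derivatives do not vanish. So the points
  of \<open>A\<close> on the curve fall into boundedly many convex chains and collinear sets, apart from those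
  on the vertical lines \<open>P = 0\<close>; collinear sets have fewer than \<open>k\<close> points.
\<close>

no_notation fps_nth (infixl "$" 75)

section \<open>Blocking a convex chain\<close>

text \<open>Twice the signed area of the triangle \<open>p q r\<close>: positive for a left turn,
  zero for collinear points.\<close>

definition orient :: "real ^ 2 \<Rightarrow> real ^ 2 \<Rightarrow> real ^ 2 \<Rightarrow> real" where
  "orient p q r = (q $ 1 - p $ 1) * (r $ 2 - p $ 2) - (q $ 2 - p $ 2) * (r $ 1 - p $ 1)"

text \<open>The real factor \<open>\<sigma>\<close> covers convex and concave chains at once; only
  its sign matters.\<close>

definition convex_chain :: "real \<Rightarrow> nat \<Rightarrow> (nat \<Rightarrow> real ^ 2) \<Rightarrow> bool" where
  "convex_chain \<sigma> m p \<longleftrightarrow>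
     (\<forall>i j. i < j \<longrightarrow> j < m \<longrightarrow> p i $ 1 < p j $ 1) \<and>
     (\<forall>i j k. i < j \<longrightarrow> j < k \<longrightarrow> k < m \<longrightarrow> \<sigma> * orient (p i) (p j) (p k) > 0)"

lemma convex_chain_less: "convex_chain \<sigma> m p \<Longrightarrow> i < j \<Longrightarrow> j < m \<Longrightarrow> p i $ 1 < p j $ 1"
  by (simp add: convex_chain_def)

lemma convex_chain_orient:
  "convex_chain \<sigma> m p \<Longrightarrow> i < j \<Longrightarrow> j < k \<Longrightarrow> k < m \<Longrightarrow> \<sigma> * orient (p i) (p j) (p k) > 0"
  by (simp add: convex_chain_def)

lemma convex_chain_inj:
  assumes "convex_chain \<sigma> m p"
  shows "inj_on p {..<m}"
  by (rule inj_onI, metis assms convex_chain_less lessThan_iff less_irrefl linorder_neqE_nat)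

lemma open_segment_coords:
  fixes y p q :: "real ^ 2"
  assumes "y \<in> open_segment p q"
  obtains t where "0 < t" "t < 1" "y $ 1 = (1 - t) * p $ 1 + t * q $ 1"
    "y $ 2 = (1 - t) * p $ 2 + t * q $ 2"
  using assms by (auto simp: in_segment)

lemma open_segment_first_coord:
  fixes y p q :: "real ^ 2"
  assumes "y \<in> open_segment p q" "p $ 1 < q $ 1"
  shows "p $ 1 < y $ 1" "y $ 1 < q $ 1"
proof -
  obtain t where t: "0 < t" "t < 1" "y $ 1 = (1 - t) * p $ 1 + t * q $ 1"
    using assms(1) by (rule open_segment_coords)
  have e: "y $ 1 - p $ 1 = t * (q $ 1 - p $ 1)" "q $ 1 - y $ 1 = (1 - t) * (q $ 1 - p $ 1)"
    by (simp_all add: t(3) algebra_simps)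
  have "0 < y $ 1 - p $ 1" "0 < q $ 1 - y $ 1"
    unfolding e using t assms(2) by simp_all
  then show "p $ 1 < y $ 1" "y $ 1 < q $ 1" by simp_all
qed

text \<open>The affine function \<open>h\<close> vanishes along the outer chord and is positive at
  every vertex strictly between its ends. At least one end of the inner chord is such a vertex and
  \<open>h\<close> is nonnegative at the other, so \<open>h\<close> is positive on the open inner
  chord.\<close>

lemma chords_not_nested:
  assumes c: "convex_chain \<sigma> m p"
    and ord: "a \<le> a'" "a' < b'" "b' \<le> b" "b < m" and ne: "(a, b) \<noteq> (a', b')"
    and y: "y \<in> open_segment (p a) (p b)" and y': "y \<in> open_segment (p a') (p b')"
  shows False
proof -
  define h where "h q = \<sigma> * orient (p a) q (p b)" for q
  have pos: "h (p i) > 0" if "a < i" "i < b" for i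
    unfolding h_def using convex_chain_orient[OF c that ord(4)] .
  have zero: "h (p a) = 0" "h (p b) = 0"
    by (simp_all add: h_def orient_def)
  obtain t where t: "0 < t" "t < 1" "y $ 1 = (1 - t) * p a' $ 1 + t * p b' $ 1"
    "y $ 2 = (1 - t) * p a' $ 2 + t * p b' $ 2"
    using y' by (rule open_segment_coords)
  have hy': "h y = (1 - t) * h (p a') + t * h (p b')"
    unfolding h_def orient_def t(3,4) by algebra
  obtain s where s: "0 < s" "s < 1" "y $ 1 = (1 - s) * p a $ 1 + s * p b $ 1"
    "y $ 2 = (1 - s) * p a $ 2 + s * p b $ 2"
    using y by (rule open_segment_coords)
  have "h y = 0"
    unfolding h_def orient_def s(3,4) by algebra
  moreover have "h (p a') \<ge> 0" "h (p b') \<ge> 0"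
    using pos[of a'] pos[of b'] zero ord by (cases "a' = a"; cases "b' = b"; force)+
  moreover have "h (p a') > 0 \<or> h (p b') > 0"
    using pos[of a'] pos[of b'] ord ne by (cases "a' = a"; cases "b' = b"; force)
  ultimately show False
    using hy' t by (auto simp: add_nonneg_eq_0_iff)
qed

text \<open>The first coordinate of \<open>y\<close> would lie on both sides of that of
  \<open>p b\<close>.\<close>

lemma chords_not_disjoint:
  assumes c: "convex_chain \<sigma> m p"
    and ord: "a < b" "b \<le> a'" "a' < b'" "b' < m"
    and y: "y \<in> open_segment (p a) (p b)" and y': "y \<in> open_segment (p a') (p b')"
  shows False
proof -
  have "y $ 1 < p b $ 1"
    using open_segment_first_coord(2)[OF y] convex_chain_less[OF c] ord by simp
  also have "p b $ 1 \<le> p a' $ 1"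
    using convex_chain_less[OF c, of b a'] ord by (cases "b = a'") auto
  also have "\<dots> < y $ 1"
    using open_segment_first_coord(1)[OF y'] convex_chain_less[OF c] ord by simp
  finally show False .
qed

definition chords_through :: "nat \<Rightarrow> (nat \<Rightarrow> real ^ 2) \<Rightarrow> real ^ 2 \<Rightarrow> (nat \<times> nat) set" where
  "chords_through m p y = {(a, b). a < b \<and> b < m \<and> y \<in> open_segment (p a) (p b)}"

lemma finite_chords_through: "finite (chords_through m p y)"
  by (rule finite_subset[of _ "{..<m} \<times> {..<m}"]) (auto simp: chords_through_def)

lemma chords_cross:
  assumes c: "convex_chain \<sigma> m p"
    and "(a, b) \<in> chords_through m p y" "(a', b') \<in> chords_through m p y" "(a, b) \<noteq> (a', b')"
  shows "a < a' \<and> a' < b \<and> b < b' \<or> a' < a \<and> a < b' \<and> b' < b"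
proof -
  have 1: "a < b" "b < m" "y \<in> open_segment (p a) (p b)"
    and 2: "a' < b'" "b' < m" "y \<in> open_segment (p a') (p b')"
    using assms by (auto simp: chords_through_def)
  have "\<not> (a \<le> a' \<and> b' \<le> b)" "\<not> (a' \<le> a \<and> b \<le> b')" "\<not> b \<le> a'" "\<not> b' \<le> a"
    using chords_not_nested[OF c _ 2(1) _ 1(2) assms(4) 1(3) 2(3)]
      chords_not_nested[OF c _ 1(1) _ 2(2) assms(4)[symmetric] 2(3) 1(3)]
      chords_not_disjoint[OF c 1(1) _ 2(1,2) 1(3) 2(3)]
      chords_not_disjoint[OF c 2(1) _ 1(1,2) 2(3) 1(3)] by blast+
  then show ?thesis by linarith
qed

text \<open>Every further chord through \<open>y\<close> crosses \<open>(a, b)\<close>, so exactly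
  one of its end indices lies strictly between \<open>a\<close> and \<open>b\<close>. Crossing
  chords share no end index, so these indices are distinct, and only \<open>b - a - 1\<close> are
  available.\<close>

lemma card_chords_through_le:
  assumes c: "convex_chain \<sigma> m p" and ab: "(a, b) \<in> chords_through m p y"
  shows "card (chords_through m p y) \<le> b - a"
proof -
  let ?B = "chords_through m p y"
  \<comment> \<open>\<open>e\<close> picks the end index strictly between \<open>a\<close> and
    \<open>b\<close>.\<close>
  define e where "e = (\<lambda>(a', b'). if a < a' then a' else b')"
  have lt: "a < b" using ab by (auto simp: chords_through_def)
  have "inj_on e (?B - {(a, b)})"
  proof (rule inj_onI, goal_cases)
    case (1 u v)
    obtain a1 b1 a2 b2 where uv: "u = (a1, b1)" "v = (a2, b2)" by (cases u, cases v)
    have "a1 < b1" "a2 < b2" using 1 uv by (auto simp: chords_through_def)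
    moreover have "u \<noteq> v \<Longrightarrow> a1 < a2 \<and> a2 < b1 \<and> b1 < b2 \<or> a2 < a1 \<and> a1 < b2 \<and> b2 < b1"
      using chords_cross[OF c, of a1 b1 y a2 b2] 1 uv by auto
    moreover have "e u = e v" using 1 by simp
    ultimately show ?case
      using uv by (auto simp: e_def split: if_splits)
  qed
  moreover have "e ` (?B - {(a, b)}) \<subseteq> {a<..<b}"
  proof
    fix x assume "x \<in> e ` (?B - {(a, b)})"
    then obtain a' b' where "(a', b') \<in> ?B" "(a', b') \<noteq> (a, b)" "x = e (a', b')" by auto
    with chords_cross[OF c ab, of a' b'] show "x \<in> {a<..<b}"
      by (auto simp: e_def split: if_splits)
  qed
  ultimately have "card (?B - {(a, b)}) \<le> card {a<..<b}"
    by (intro card_inj_on_le) auto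
  then show ?thesis
    using lt ab finite_chords_through[of m p y] by (simp add: card_Diff_singleton)
qed

text \<open>If \<open>n\<close> chords pass through \<open>y\<close>, each spans at least
  \<open>n\<close> indices, so every term is at most \<open>1 / n\<close>.\<close>

lemma sum_chords_through_le:
  assumes c: "convex_chain \<sigma> m p"
  shows "(\<Sum>(a, b)\<in>chords_through m p y. 1 / (real b - real a)) \<le> 1"
proof -
  let ?B = "chords_through m p y"
  have "(\<Sum>(a, b)\<in>?B. 1 / (real b - real a)) \<le> (\<Sum>_\<in>?B. 1 / real (card ?B))"
  proof (rule sum_mono, clarify)
    fix a b assume ab: "(a, b) \<in> ?B"
    then have "a < b" by (auto simp: chords_through_def)
    moreover have "card ?B > 0" using ab finite_chords_through card_gt_0_iff by blast
    moreover have "real (card ?B) \<le> real b - real a"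
      using card_chords_through_le[OF c ab] \<open>a < b\<close> by linarith
    ultimately show "1 / (real b - real a) \<le> 1 / real (card ?B)"
      by (intro divide_left_mono) auto
  qed
  also have "\<dots> \<le> 1" by simp
  finally show ?thesis .
qed

lemma open_segment_in_chords_through:
  assumes "a < b" "b < m" "y \<in> open_segment (p a) (p b) \<inter> A"
  shows "(a, b) \<in> chords_through m p y" "y \<in> A"
  using assms by (auto simp: chords_through_def)

section \<open>Weighted count of blocked progressions\<close>

text \<open>Double counting: a progression with difference \<open>g\<close> has weight
  \<open>1 / g\<close> and is charged to a blocked pair of its points together with a blocker. The
  chords through one blocker have total weight at most 1; the \<open>l ^ 2\<close> pairs of
  positions and a factor \<open>l\<close> for \<open>t' - t\<close> account for
  \<open>l ^ 3\<close>.\<close>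

lemma harm_le_of_blocked_progressions:
  fixes p :: "nat \<Rightarrow> real ^ 2"
  assumes c: "convex_chain \<sigma> m p" and "finite A"
    and fits: "\<And>i g. i < M \<Longrightarrow> g \<in> {1..G} \<Longrightarrow> i + (l - 1) * g < m"
    and blocked: "\<And>i g. i < M \<Longrightarrow> g \<in> {1..G} \<Longrightarrow>
      \<exists>t t'. t < t' \<and> t' < l \<and> open_segment (p (i + t * g)) (p (i + t' * g)) \<inter> A \<noteq> {}"
  shows "real M * harm G \<le> real l ^ 3 * real (card A)"
proof -
  let ?I = "{..<M} \<times> {1..G}"
  let ?good = "\<lambda>ig z. case z of (t, t', y) \<Rightarrow>
      t < t' \<and> t' < l \<and> y \<in> open_segment (p (fst ig + t * snd ig)) (p (fst ig + t' * snd ig)) \<inter> A"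
  have "\<forall>ig\<in>?I. \<exists>z. ?good ig z"
    using blocked by fastforce
  then obtain z where "\<forall>ig\<in>?I. ?good ig (z ig)"
    by (rule bchoice[THEN exE])
  then have z: "?good ig (z ig)" if "ig \<in> ?I" for ig
    using that by (rule bspec)
  \<comment> \<open>Keeping the positions \<open>t, t'\<close> next to the chord makes the map
    injective: two vertices and their positions determine the progression.\<close>
  define \<Phi> where "\<Phi> ig = (case z ig of (t, t', y) \<Rightarrow>
      ((y, (fst ig + t * snd ig, fst ig + t' * snd ig)), (t, t')))" for ig
  define T where "T = (SIGMA y:A. chords_through m p y) \<times> ({..<l} \<times> {..<l})"
  \<comment> \<open>The chord spans \<open>(t' - t) * g < l * g\<close> indices, so the factor
    \<open>l\<close> makes its weight dominate \<open>1 / g\<close>.\<close>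
  define w :: "(((real ^ 2) \<times> nat \<times> nat) \<times> nat \<times> nat) \<Rightarrow> real"
    where "w = (\<lambda>((y, (a, b)), _). real l * (1 / (real b - real a)))"
  have in_T: "\<Phi> ig \<in> T" and le_w: "1 / real (snd ig) \<le> w (\<Phi> ig)" if ig: "ig \<in> ?I" for ig
  proof -
    obtain i g where [simp]: "ig = (i, g)" by (cases ig)
    obtain t t' y where ty: "z (i, g) = (t, t', y)" by (cases "z (i, g)") auto
    have g: "i < M" "g \<ge> 1" "g \<in> {1..G}" using ig by auto
    have zz: "t < t'" "t' < l" "y \<in> open_segment (p (i + t * g)) (p (i + t' * g)) \<inter> A"
      using z[OF ig] by (auto simp: ty)
    have "t' * g \<le> (l - 1) * g" using zz(2) by (intro mult_right_mono) auto
    then have "i + t' * g < m" using fits[OF g(1,3)] by linarith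
    moreover have "i + t * g < i + t' * g" using zz g by simp
    ultimately have "(i + t * g, i + t' * g) \<in> chords_through m p y" "y \<in> A"
      using zz(3) by (blast intro: open_segment_in_chords_through)+
    then show "\<Phi> ig \<in> T"
      using zz by (auto simp: T_def \<Phi>_def ty)
    have "real t' * real g - real t * real g = (real t' - real t) * real g"
      by (simp add: algebra_simps)
    moreover have "1 / real g \<le> real l / ((real t' - real t) * real g)"
      using zz(1,2) g
      by (simp add: divide_simps)
    ultimately show "1 / real (snd ig) \<le> w (\<Phi> ig)"
      by (simp add: w_def \<Phi>_def ty)
  qed
  have inj: "inj_on \<Phi> ?I"
  proof (rule inj_onI, goal_cases)
    case (1 u v)
    obtain i g j h where uv: "u = (i, g)" "v = (j, h)" by (cases u, cases v)
    obtain t t' y where ty: "z u = (t, t', y)" by (cases "z u") auto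
    obtain s s' y' where sy: "z v = (s, s', y')" by (cases "z v") auto
    have "t < t'" using z[OF 1(1)] by (auto simp: ty)
    have eq: "i + t * g = j + t * h" "i + t' * g = j + t' * h"
      using 1(3) ty sy uv by (auto simp: \<Phi>_def)
    then have "int i + int t * int g = int j + int t * int h"
      "int i + int t' * int g = int j + int t' * int h"
      by (metis of_nat_add of_nat_mult)+
    then have "(int t' - int t) * (int g - int h) = 0" by (simp add: algebra_simps)
    with \<open>t < t'\<close> have "g = h" by simp
    with eq show ?case by (simp add: uv)
  qed
  have finT: "finite T"
    unfolding T_def using \<open>finite A\<close> finite_chords_through by (intro finite_cartesian_product finite_SigmaI) auto
  have w_nonneg: "w x \<ge> 0" if "x \<in> T" for x
    using that by (auto simp: w_def T_def chords_through_def)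
  have "real M * harm G = (\<Sum>i<M. \<Sum>g\<in>{1..G}. 1 / real g)"
    by (simp add: harm_def inverse_eq_divide)
  also have "\<dots> = (\<Sum>ig\<in>?I. 1 / real (snd ig))"
    by (simp only: sum.cartesian_product split_def)
  also have "\<dots> \<le> (\<Sum>ig\<in>?I. w (\<Phi> ig))"
    by (rule sum_mono) (rule le_w)
  also have "\<dots> = sum w (\<Phi> ` ?I)"
    using sum.reindex[OF inj, of w] by (simp only: o_def)
  also have "\<dots> \<le> sum w T"
    using finT in_T w_nonneg by (intro sum_mono2) auto
  also have "\<dots> = (\<Sum>x\<in>(SIGMA y:A. chords_through m p y).
      real l ^ 3 * (case x of (y, (a, b)) \<Rightarrow> 1 / (real b - real a)))"
    unfolding T_def w_def
    by (subst sum.cartesian_product[symmetric]) (auto intro!: sum.cong simp: power3_eq_cube)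
  also have "\<dots> = real l ^ 3 * (\<Sum>y\<in>A. \<Sum>(a, b)\<in>chords_through m p y. 1 / (real b - real a))"
    using \<open>finite A\<close> finite_chords_through
    by (subst sum.Sigma) (auto simp: sum_distrib_left split_def)
  also have "\<dots> \<le> real l ^ 3 * (\<Sum>y\<in>A. 1)"
    by (intro mult_left_mono sum_mono sum_chords_through_le[OF c]) auto
  finally show ?thesis by simp
qed

text \<open>\<open>K\<close> bounds how sparse the chain may be in \<open>A\<close>. If every
  progression starting in the first half with difference at most \<open>G\<close> were blocked, the
  weighted count would bound \<open>harm G\<close> independently of \<open>m\<close>, whereas
  harmonic sums diverge. The points of an unblocked progression see each other.\<close>

lemma convex_chain_visible_subset:
  fixes l K :: nat
  assumes "l \<ge> 1"
  shows "\<exists>m0. \<forall>m \<sigma> p A. m0 \<le> m \<longrightarrow> convex_chain \<sigma> m p \<longrightarrow> finite A \<longrightarrow> p ` {..<m} \<subseteq> A \<longrightarrow>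
           card A \<le> K * m \<longrightarrow> (\<exists>S. card S = l \<and> mutually_visible A S)"
proof -
  \<comment> \<open>The factor 3 comes from \<open>m \<le> 3 * M\<close> for
    \<open>M = m div 2\<close>.\<close>
  obtain G where G: "harm G > (real l ^ 3 * real (3 * K + 1) :: real)"
    using filterlim_at_top_dense[THEN iffD1, OF harm_at_top]
    by (meson eventually_happens sequentially_bot)
  show ?thesis
  \<comment> \<open>The threshold gives \<open>l * G < M\<close>, so a start below \<open>M\<close>
    leaves room for a full progression.\<close>
  proof (intro exI[of _ "2 * (l * G + 1)"] allI impI)
    fix m \<sigma> p A
    assume m: "2 * (l * G + 1) \<le> m" and c: "convex_chain \<sigma> m p" and fin: "finite (A :: (real^2) set)"
      and sub: "p ` {..<m} \<subseteq> A" and card: "card A \<le> K * m"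
    define M where "M = m div 2"
    have M: "M \<ge> l * G + 1" "2 * M \<le> m" "m \<le> 3 * M"
      using m by (auto simp: M_def)
    have fits: "i + (l - 1) * g < m" if "i < M" "g \<in> {1..G}" for i g
    proof -
      have "(l - 1) * g \<le> l * G" using that by (intro mult_mono) auto
      with that M show ?thesis by linarith
    qed
    have "\<exists>i g. i < M \<and> g \<in> {1..G} \<and>
      (\<forall>t t'. t < t' \<longrightarrow> t' < l \<longrightarrow> open_segment (p (i + t * g)) (p (i + t' * g)) \<inter> A = {})"
    proof (rule ccontr)
      assume none: "\<not> ?thesis"
      have "real M * harm G \<le> real l ^ 3 * real (card A)"
      proof (rule harm_le_of_blocked_progressions[OF c fin fits])
        show "\<exists>t t'. t < t' \<and> t' < l \<and> open_segment (p (i + t * g)) (p (i + t' * g)) \<inter> A \<noteq> {}"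
          if "i < M" "g \<in> {1..G}" for i g
          using none that by metis
      qed
      also have "\<dots> \<le> real l ^ 3 * real (3 * K * M)"
      proof -
        have "card A \<le> 3 * K * M"
          using order_trans[OF card mult_le_mono2[OF M(3)]] by (simp add: ac_simps)
        then show ?thesis
          by (intro mult_left_mono) (simp_all only: of_nat_le_iff zero_le_power of_nat_0_le_iff)
      qed
      also have "\<dots> = real M * (real l ^ 3 * real (3 * K))" by simp
      also have "\<dots> \<le> real M * (real l ^ 3 * real (3 * K + 1))"
        by (intro mult_left_mono) auto
      also have "\<dots> < real M * harm G"
        using G M by (intro mult_strict_left_mono) auto
      finally show False by simp
    qed
    then obtain i g where ig: "i < M" "g \<in> {1..G}" and
      vis: "\<And>t t'. t < t' \<Longrightarrow> t' < l \<Longrightarrow> open_segment (p (i + t * g)) (p (i + t' * g)) \<inter> A = {}"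
      by blast
    define q where "q t = p (i + t * g)" for t
    have lt: "i + t * g < m" if "t < l" for t
    proof -
      have "t * g \<le> (l - 1) * g" using that by (intro mult_right_mono) auto
      then show ?thesis using fits[OF ig] by linarith
    qed
    have inj: "inj_on q {..<l}"
    proof (rule inj_onI)
      fix s t assume "s \<in> {..<l}" "t \<in> {..<l}" "q s = q t"
      then have "i + s * g = i + t * g"
        using inj_onD[OF convex_chain_inj[OF c], of "i + s * g" "i + t * g"] lt by (auto simp: q_def)
      then show "s = t" using ig by simp
    qed
    have "visible_in A (q s) (q t)" if "s < l" "t < l" "s \<noteq> t" for s t
      using that vis[of s t] vis[of t s]
      by (cases "s < t") (auto simp: visible_in_def q_def open_segment_commute)
    then have "mutually_visible A (q ` {..<l})"
      using sub lt by (auto simp: mutually_visible_def pairwise_def q_def image_subset_iff)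
    moreover have "card (q ` {..<l}) = l"
      by (simp add: card_image[OF inj])
    ultimately show "\<exists>S. card S = l \<and> mutually_visible A S" by blast
  qed
qed

section \<open>Elimination\<close>

definition ev :: "real poly poly \<Rightarrow> real \<Rightarrow> real \<Rightarrow> real" where
  "ev f x y = poly (poly f [:y:]) x"

lemma eval2_eq_ev: "eval2 f p = ev f (p $ 1) (p $ 2)"
  by (simp add: eval2_def ev_def)

lemma ev_simps [simp]:
  "ev 0 x y = 0"
  "ev (pCons c f) x y = poly c x + y * ev f x y"
  "ev (f + g) x y = ev f x y + ev g x y"
  "ev (f - g) x y = ev f x y - ev g x y"
  "ev (f * g) x y = ev f x y * ev g x y"
  "ev (smult c f) x y = poly c x * ev f x y"
  "ev (f ^ n) x y = ev f x y ^ n"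
  "ev (monom c n) x y = poly c x * y ^ n"
  by (simp_all add: ev_def poly_monom poly_power)

lemma ev_dvd: "f dvd g \<Longrightarrow> ev f x y = 0 \<Longrightarrow> ev g x y = 0"
  by (auto elim!: dvdE)

text \<open>The degree in \<open>x\<close>: the coefficients of \<open>f\<close> are polynomials in
  \<open>x\<close>, while \<open>degree f\<close> counts powers of \<open>y\<close>.\<close>

definition xdeg_le :: "nat \<Rightarrow> real poly poly \<Rightarrow> bool" where
  "xdeg_le e f \<longleftrightarrow> (\<forall>i. degree (coeff f i) \<le> e)"

lemma xdeg_le_mono: "xdeg_le e f \<Longrightarrow> e \<le> e' \<Longrightarrow> xdeg_le e' f"
  by (auto simp: xdeg_le_def intro: order_trans)

lemma xdeg_le_add: "xdeg_le e f \<Longrightarrow> xdeg_le e g \<Longrightarrow> xdeg_le e (f + g)"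
  by (auto simp: xdeg_le_def intro: degree_add_le)

lemma xdeg_le_diff: "xdeg_le e f \<Longrightarrow> xdeg_le e g \<Longrightarrow> xdeg_le e (f - g)"
  by (auto simp: xdeg_le_def intro: degree_diff_le)

lemma xdeg_le_mult: "xdeg_le a f \<Longrightarrow> xdeg_le b g \<Longrightarrow> xdeg_le (a + b) (f * g)"
  unfolding xdeg_le_def coeff_mult
  by (intro allI degree_sum_le) (auto intro!: order_trans[OF degree_mult_le] add_mono)

lemma xdeg_le_smult: "degree c \<le> a \<Longrightarrow> xdeg_le b f \<Longrightarrow> xdeg_le (a + b) (smult c f)"
  by (auto simp: xdeg_le_def intro!: order_trans[OF degree_mult_le] add_mono)

lemma xdeg_le_pderiv: "xdeg_le e f \<Longrightarrow> xdeg_le e (pderiv f)"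
  by (auto simp: xdeg_le_def coeff_pderiv of_nat_poly simp del: of_nat_Suc intro: order_trans[OF degree_smult_le])

lemma xdeg_le_map_pderiv: "xdeg_le e f \<Longrightarrow> xdeg_le e (map_poly pderiv f)"
  by (auto simp: xdeg_le_def coeff_map_poly degree_pderiv intro!: order_trans[OF diff_le_self])

lemma degree_map_pderiv_le: "degree (map_poly pderiv f) \<le> degree f"
  by (rule degree_le) (simp add: coeff_map_poly coeff_eq_0)

text \<open>A prime of positive degree in \<open>y\<close> cannot divide the nonzero
  \<open>c\<close>, which is free of \<open>y\<close>; primality then passes the divisibility on to
  \<open>f\<close>.\<close>

lemma prime_elem_dvd_smult:
  assumes "prime_elem q" "degree q > 0" "q dvd smult c f" "c \<noteq> 0"
  shows "q dvd (f :: real poly poly)"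
proof -
  have "q dvd [:c:] * f" using assms(3) by simp
  moreover have "\<not> q dvd [:c:]"
    using dvd_imp_degree_le[of q "[:c:]"] assms(2,4) by auto
  ultimately show ?thesis using assms(1) prime_elem_dvd_mult_iff by blast
qed

text \<open>If all prime factors were free of \<open>y\<close>, so would be their product, which is
  an associate of \<open>f\<close>.\<close>

lemma exists_prime_factor_pos_degree:
  fixes f :: "real poly poly"
  assumes "f \<noteq> 0" "degree f > 0"
  shows "\<exists>q. prime_elem q \<and> degree q > 0 \<and> q dvd f"
proof (rule ccontr)
  assume no: "\<not> ?thesis"
  obtain M where M: "\<And>q. q \<in># M \<Longrightarrow> prime q" "normalize (prod_mset M) = normalize f"
    by (rule prime_factorization_exists'[OF assms(1)]) blast
  have dvd: "prod_mset M dvd f" "f dvd prod_mset M"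
    using M(2) by (metis associated_iff_dvd)+
  have "degree (prod_mset N) = 0" if "\<And>q. q \<in># N \<Longrightarrow> degree q = 0" for N :: "real poly poly multiset"
    using that
  proof (induction N)
    case (add q N)
    then show ?case using degree_mult_le[of q "prod_mset N"] by simp
  qed simp
  moreover have "degree q = 0" if "q \<in># M" for q
    using no M(1)[OF that] dvd_trans[OF dvd_prod_mset[OF that] dvd(1)] by auto
  ultimately have "degree (prod_mset M) = 0" by blast
  moreover have "prod_mset M \<noteq> 0" using dvd(1) assms(1) by auto
  ultimately show False
    using dvd_imp_degree_le[OF dvd(2)] assms(2) by simp
qed

text \<open>
  Pseudo-division eliminates the leading coefficient at the cost of doubling the degree in \<open>x\<close>,
  so the degree of the eliminant is bounded in terms of the degrees alone.
\<close>

lemma eliminant_exists: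
  "\<exists>D. \<forall>f g. degree f + degree g \<le> n \<longrightarrow> xdeg_le e f \<longrightarrow> xdeg_le e g \<longrightarrow> f \<noteq> 0 \<or> g \<noteq> 0 \<longrightarrow>
     (\<forall>q. prime_elem q \<longrightarrow> degree q > 0 \<longrightarrow> q dvd f \<longrightarrow> \<not> q dvd g) \<longrightarrow>
     (\<exists>P. P \<noteq> 0 \<and> degree P \<le> D \<and> (\<forall>x y. ev f x y = 0 \<longrightarrow> ev g x y = 0 \<longrightarrow> poly P x = 0))"
proof (induction n arbitrary: e rule: less_induct)
  case (less n)
  let ?co = "\<lambda>f g. \<forall>q. prime_elem q \<longrightarrow> degree q > 0 \<longrightarrow> q dvd f \<longrightarrow> \<not> q dvd g"
  let ?el = "\<lambda>D f g. \<exists>P. P \<noteq> 0 \<and> degree P \<le> D \<and>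
      (\<forall>x y. ev f x y = 0 \<longrightarrow> ev g x y = 0 \<longrightarrow> poly P x = 0)"
  \<comment> \<open>The induction hypothesis is taken with the doubled degree in \<open>x\<close>.
    The premise \<open>n > 0\<close> stays inside so that a \<open>D\<close> exists for
    \<open>n = 0\<close> as well.\<close>
  have "\<exists>D. \<forall>f g. n > 0 \<longrightarrow> degree f + degree g \<le> n - 1 \<longrightarrow> xdeg_le (2 * e) f \<longrightarrow>
      xdeg_le (2 * e) g \<longrightarrow> f \<noteq> 0 \<or> g \<noteq> 0 \<longrightarrow> ?co f g \<longrightarrow> ?el D f g"
  proof (cases "n > 0")
    case True
    from less.IH[of "n - 1" "2 * e"] True show ?thesis by (simp only: diff_less zero_less_one simp_thms)
  qed simp
  then obtain D where D: "?el D f g" if "n > 0" "degree f + degree g \<le> n - 1" "xdeg_le (2 * e) f"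
      "xdeg_le (2 * e) g" "f \<noteq> 0 \<or> g \<noteq> 0" "?co f g" for f g
    by metis
  have ordered: "?el (max D e) f g"
    if le: "degree f + degree g \<le> n" and xf: "xdeg_le e f" and xg: "xdeg_le e g"
      and nz: "f \<noteq> 0 \<or> g \<noteq> 0" and co: "?co f g" and deg: "degree g \<le> degree f" for f g
  proof (cases "degree g = 0 \<and> g \<noteq> 0")
    case True
    then obtain c where c: "g = [:c:]" "c \<noteq> 0" by (metis degree_eq_zeroE pCons_0_0)
    then have "degree c \<le> e" using xg by (auto simp: xdeg_le_def dest: spec[of _ 0])
    then show ?thesis using c by (intro exI[of _ c]) auto
  next
    case False
    show ?thesis
    proof (cases "g = 0")
      case True
      have "f \<noteq> 0" using nz True by simp
      \<comment> \<open>With \<open>g = 0\<close> every factor of \<open>f\<close> is common, so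
        coprimality leaves \<open>f\<close> no prime factor of positive degree in
        \<open>y\<close>.\<close>
      moreover have "degree f = 0"
        using exists_prime_factor_pos_degree[OF \<open>f \<noteq> 0\<close>] co True by auto
      ultimately obtain c where c: "f = [:c:]" "c \<noteq> 0" by (metis degree_eq_zeroE pCons_0_0)
      then have "degree c \<le> e" using xf by (auto simp: xdeg_le_def dest: spec[of _ 0])
      then show ?thesis using c by (intro exI[of _ c]) auto
    next
      case nz: False
      with False have dg: "degree g > 0" by simp
      have nf: "f \<noteq> 0" using dg deg by auto
      define k where "k = degree f - degree g"
      \<comment> \<open>The leading terms cancel, and \<open>h\<close> vanishes at every common zero
        of \<open>f\<close> and \<open>g\<close>.\<close>
      define h where "h = smult (lead_coeff g) f - smult (lead_coeff f) (monom 1 k * g)"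
      have "degree (smult (lead_coeff g) f) = degree f"
        using nz by simp
      moreover have dm: "degree (smult (lead_coeff f) (monom 1 k * g)) = degree f"
        using nz nf deg by (simp add: degree_mult_eq degree_monom_eq k_def)
      moreover have "coeff h (degree f) = 0"
        using deg by (simp add: h_def k_def coeff_monom_mult)
      ultimately have "degree h \<le> degree f" "coeff h (degree f) = 0"
        by (auto simp: h_def intro: degree_diff_le)
      then have dh: "degree h < degree f"
        using dg deg by (metis eq_zero_or_degree_less degree_0 order_less_le_trans)
      have "xdeg_le (e + e) h"
        unfolding h_def using xf xg
        by (intro xdeg_le_diff xdeg_le_smult)
          (auto simp: xdeg_le_def coeff_monom_mult)
      then have xh: "xdeg_le (2 * e) h" by (simp add: mult_2)
      \<comment> \<open>A common prime factor of \<open>h\<close> and \<open>g\<close> with positive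
        degree in \<open>y\<close> would divide \<open>lead_coeff g\<close> times \<open>f\<close>,
        hence \<open>f\<close>.\<close>
      have "?co h g"
      proof (intro allI impI notI)
        fix q assume q: "prime_elem q" "degree q > 0" "q dvd h" "q dvd g"
        have "q dvd h + smult (lead_coeff f) (monom 1 k * g)"
          using q by (intro dvd_add dvd_smult dvd_mult) auto
        then have "q dvd smult (lead_coeff g) f" by (simp add: h_def)
        then have "q dvd f" using q nz prime_elem_dvd_smult[of q "lead_coeff g" f] by simp
        with co q show False by blast
      qed
      moreover have "degree h + degree g \<le> n - 1" using dh le by linarith
      moreover have "xdeg_le (2 * e) g" using xg by (rule xdeg_le_mono) simp
      moreover have "n > 0" using dg le by linarith
      ultimately obtain P where P: "P \<noteq> 0" "degree P \<le> D"
        "\<And>x y. ev h x y = 0 \<Longrightarrow> ev g x y = 0 \<Longrightarrow> poly P x = 0"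
        using D[of h g] xh nz by metis
      have "ev h x y = 0" if "ev f x y = 0" "ev g x y = 0" for x y
        using that by (simp add: h_def)
      with P show ?thesis by (intro exI[of _ P]) auto
    qed
  qed
  show ?case
  proof (intro exI[of _ "max D e"] allI impI, goal_cases)
    case (1 f g)
    show ?case
    proof (cases "degree g \<le> degree f")
      case True
      then show ?thesis using 1 by (intro ordered) auto
    next
      case False
      then have "?el (max D e) g f"
        using 1 by (intro ordered) (auto simp: add.commute)
      then show ?thesis by blast
    qed
  qed
qed

section \<open>Curvature of the curve and its exceptional abscissae\<close>

text \<open>\<open>map_poly pderiv\<close> differentiates in \<open>x\<close> and
  \<open>pderiv\<close> in \<open>y\<close>. This is the negative of the bordered Hessian
  determinant; on a graph \<open>y = g x\<close> in the curve with \<open>pderiv f\<close> nonzero,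
  the second derivative of \<open>g\<close> is \<open>- hess f\<close> over the cube of
  \<open>pderiv f\<close>.\<close>

definition hess :: "real poly poly \<Rightarrow> real poly poly" where
  "hess f = map_poly pderiv (map_poly pderiv f) * (pderiv f)\<^sup>2
     - 2 * map_poly pderiv (pderiv f) * map_poly pderiv f * pderiv f
     + pderiv (pderiv f) * (map_poly pderiv f)\<^sup>2"

lemma degree_xdeg_hess:
  assumes "degree f \<le> d" "xdeg_le d f"
  shows "degree (hess f) \<le> 3 * d" "xdeg_le (3 * d) (hess f)"
proof -
  let ?X = "map_poly pderiv"
  have x: "xdeg_le d (?X f)" "xdeg_le d (pderiv f)" "xdeg_le d (?X (?X f))"
    "xdeg_le d (?X (pderiv f))" "xdeg_le d (pderiv (pderiv f))"
    using assms(2) by (auto intro: xdeg_le_map_pderiv xdeg_le_pderiv)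
  have y: "degree (?X f) \<le> d" "degree (pderiv f) \<le> d" "degree (?X (?X f)) \<le> d"
    "degree (?X (pderiv f)) \<le> d" "degree (pderiv (pderiv f)) \<le> d"
    using assms(1) by (auto intro!: order_trans[OF degree_map_pderiv_le] simp: degree_pderiv)
  have x2: "xdeg_le 0 2" "degree (2 :: real poly poly) \<le> 0"
    by (auto simp: xdeg_le_def numeral_poly coeff_pCons split: nat.split)
  have "xdeg_le (d + (d + d)) (?X (?X f) * (pderiv f * pderiv f))"
    "xdeg_le (0 + d + d + d) (2 * ?X (pderiv f) * ?X f * pderiv f)"
    "xdeg_le (d + (d + d)) (pderiv (pderiv f) * (?X f * ?X f))"
    by (intro xdeg_le_mult x x2)+
  then show "xdeg_le (3 * d) (hess f)"
    unfolding hess_def power2_eq_square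
    by (intro xdeg_le_add xdeg_le_diff) (simp_all add: numeral_3_eq_3 add.assoc)
  have *: "degree (a * b) \<le> m + n" if "degree a \<le> m" "degree b \<le> n" for a b :: "real poly poly" and m n
    using degree_mult_le[of a b] that by linarith
  have "degree (?X (?X f) * (pderiv f * pderiv f)) \<le> d + (d + d)"
    "degree (2 * ?X (pderiv f) * ?X f * pderiv f) \<le> 0 + d + d + d"
    "degree (pderiv (pderiv f) * (?X f * ?X f)) \<le> d + (d + d)"
    by (intro * y x2)+
  then show "degree (hess f) \<le> 3 * d"
    unfolding hess_def power2_eq_square
    by (intro degree_add_le degree_diff_le) (simp_all add: numeral_3_eq_3 add.assoc)
qed

text \<open>A prime factor of the irreducible \<open>f\<close> is an associate of \<open>f\<close>,
  so the coprimality required for elimination follows once \<open>f\<close> does not divide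
  \<open>g\<close>.\<close>

lemma irreducible_eliminant:
  "\<exists>D. \<forall>f g. irreducible f \<longrightarrow> \<not> f dvd g \<longrightarrow> degree f + degree g \<le> n \<longrightarrow> xdeg_le e f \<longrightarrow> xdeg_le e g \<longrightarrow>
     (\<exists>P. P \<noteq> 0 \<and> degree P \<le> D \<and> (\<forall>x y. ev f x y = 0 \<longrightarrow> ev g x y = 0 \<longrightarrow> poly P x = 0))"
proof -
  have "\<not> q dvd g" if "irreducible f" "\<not> f dvd g" "prime_elem q" "q dvd f" for f g q :: "real poly poly"
    using that by (meson dvd_trans irreducibleD' prime_elem_not_unit)
  moreover have "f \<noteq> 0" if "irreducible f" for f :: "real poly poly"
    using that by auto
  ultimately show ?thesis
    using eliminant_exists[of n e] by metis
qed

lemma total_degree_bounds: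
  assumes "total_degree f \<le> d"
  shows "degree f \<le> d" "xdeg_le d f"
proof -
  have *: "i + j \<le> d" if "coeff (coeff f i) j \<noteq> 0" for i j
    using assms that by (auto simp: total_degree_le_iff)
  show "degree f \<le> d"
    by (rule degree_le) (metis * add_leD1 leading_coeff_neq_0 linorder_not_less)
  show "xdeg_le d f"
    unfolding xdeg_le_def by (intro allI degree_le) (metis * add_leD2 linorder_not_less)
qed

text \<open>\<open>P\<close> is a product of three factors, whose zeros include the abscissae to be
  avoided: those where the leading coefficient vanishes and a root may escape to infinity, those of
  multiple roots, and those of zero curvature. If \<open>f\<close> divides \<open>hess f\<close>,
  then \<open>hess f\<close> vanishes on the whole curve and the third factor is 1.\<close>

lemma discriminant_exists:
  "\<exists>D. \<forall>f. irreducible f \<longrightarrow> total_degree f \<le> d \<longrightarrow>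
     (\<exists>P. P \<noteq> 0 \<and> degree P \<le> D \<and>
       (\<forall>x. poly P x \<noteq> 0 \<longrightarrow> poly (lead_coeff f) x \<noteq> 0) \<and>
       (\<forall>x y. poly P x \<noteq> 0 \<longrightarrow> ev f x y = 0 \<longrightarrow> ev (pderiv f) x y \<noteq> 0) \<and>
       (f dvd hess f \<or> (\<forall>x y. poly P x \<noteq> 0 \<longrightarrow> ev f x y = 0 \<longrightarrow> ev (hess f) x y \<noteq> 0)))"
proof -
  \<comment> \<open>Both degrees of \<open>hess f\<close> are at most \<open>3 * d\<close>, which
    dictates the bounds \<open>4 * d\<close> and \<open>3 * d\<close>.\<close>
  obtain D where D: "\<And>f g. irreducible f \<Longrightarrow> \<not> f dvd g \<Longrightarrow> degree f + degree g \<le> 4 * d \<Longrightarrow>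
     xdeg_le (3 * d) f \<Longrightarrow> xdeg_le (3 * d) g \<Longrightarrow>
     \<exists>P. P \<noteq> 0 \<and> degree P \<le> D \<and> (\<forall>x y. ev f x y = 0 \<longrightarrow> ev g x y = 0 \<longrightarrow> poly P x = 0)"
    using irreducible_eliminant[of "4 * d" "3 * d"] by auto
  show ?thesis
  proof (intro exI[of _ "d + D + D"] allI impI)
    fix f :: "real poly poly"
    assume irr: "irreducible f" and "total_degree f \<le> d"
    then have f: "degree f \<le> d" "xdeg_le d f" by (auto dest: total_degree_bounds)
    have x3: "xdeg_le (3 * d) f" "xdeg_le (3 * d) (pderiv f)"
      using f by (auto intro: xdeg_le_mono xdeg_le_pderiv)
    have nz: "f \<noteq> 0" using irr by auto
    have lc: "degree (lead_coeff f) \<le> d" "lead_coeff f \<noteq> 0" using f nz by (auto simp: xdeg_le_def)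
    \<comment> \<open>Where the leading coefficient is nonzero, a polynomial free of
      \<open>y\<close> has no zero at all, so the constant 1 serves in that case.\<close>
    have "\<exists>P. P \<noteq> 0 \<and> degree P \<le> D \<and>
        (\<forall>x y. poly (lead_coeff f) x \<noteq> 0 \<longrightarrow> ev f x y = 0 \<longrightarrow> ev (pderiv f) x y = 0 \<longrightarrow> poly P x = 0)"
    proof (cases "degree f = 0")
      case True
      then obtain c where "f = [:c:]" by (metis degree_eq_zeroE)
      then show ?thesis by (intro exI[of _ 1]) auto
    next
      case False
      then have "pderiv f \<noteq> 0" by (simp add: pderiv_eq_0_iff)
      then have "\<not> f dvd pderiv f"
        using dvd_imp_degree_le[of f "pderiv f"] False by (auto simp: degree_pderiv)
      moreover have "degree f + degree (pderiv f) \<le> 4 * d"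
        using f(1) by (simp add: degree_pderiv)
      ultimately show ?thesis
        using D[OF irr _ _ x3] by metis
    qed
    then obtain P1 where P1: "P1 \<noteq> 0" "degree P1 \<le> D" "\<And>x y. poly (lead_coeff f) x \<noteq> 0 \<Longrightarrow>
        ev f x y = 0 \<Longrightarrow> ev (pderiv f) x y = 0 \<Longrightarrow> poly P1 x = 0" by blast
    have "\<exists>P. P \<noteq> 0 \<and> degree P \<le> D \<and>
        (f dvd hess f \<or> (\<forall>x y. ev f x y = 0 \<longrightarrow> ev (hess f) x y = 0 \<longrightarrow> poly P x = 0))"
    proof (cases "f dvd hess f")
      case True
      then show ?thesis by (intro exI[of _ 1]) auto
    next
      case False
      have "degree f + degree (hess f) \<le> 4 * d"
        using f(1) degree_xdeg_hess(1)[OF f] by linarith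
      then show ?thesis
        using D[OF irr False _ x3(1) degree_xdeg_hess(2)[OF f]] by metis
    qed
    then obtain P2 where P2: "P2 \<noteq> 0" "degree P2 \<le> D"
      "f dvd hess f \<or> (\<forall>x y. ev f x y = 0 \<longrightarrow> ev (hess f) x y = 0 \<longrightarrow> poly P2 x = 0)" by blast
    show "\<exists>P. P \<noteq> 0 \<and> degree P \<le> d + D + D \<and>
       (\<forall>x. poly P x \<noteq> 0 \<longrightarrow> poly (lead_coeff f) x \<noteq> 0) \<and>
       (\<forall>x y. poly P x \<noteq> 0 \<longrightarrow> ev f x y = 0 \<longrightarrow> ev (pderiv f) x y \<noteq> 0) \<and>
       (f dvd hess f \<or> (\<forall>x y. poly P x \<noteq> 0 \<longrightarrow> ev f x y = 0 \<longrightarrow> ev (hess f) x y \<noteq> 0))"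
    proof (intro exI[of _ "lead_coeff f * P1 * P2"] conjI)
      show "degree (lead_coeff f * P1 * P2) \<le> d + D + D"
        using lc P1 P2 by (simp add: degree_mult_eq)
    qed (use lc P1 P2 in auto)
  qed
qed

section \<open>Continuity of the roots\<close>

lemma tendsto_ev [tendsto_intros]:
  assumes "(a \<longlongrightarrow> x) F" "(b \<longlongrightarrow> y) F"
  shows "((\<lambda>t. ev f (a t) (b t)) \<longlongrightarrow> ev f x y) F"
  by (induction f) (auto intro!: tendsto_intros assms)

lemma continuous_on_ev [continuous_intros]:
  assumes "continuous_on S a" "continuous_on S b"
  shows "continuous_on S (\<lambda>t. ev f (a t) (b t))"
  using assms unfolding continuous_on_def by (auto intro: tendsto_ev)

lemma DERIV_ev_snd: "((\<lambda>y. ev f x y) has_real_derivative ev (pderiv f) x y) (at y)"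
proof (induction f)
  case (pCons c f)
  show ?case
    by (rule derivative_eq_intros pCons.IH refl | simp add: pderiv_pCons)+
qed simp

lemma map_pderiv_pCons: "map_poly pderiv (pCons c f) = pCons (pderiv c) (map_poly pderiv f)"
  by (rule poly_eqI) (simp add: coeff_map_poly coeff_pCons split: nat.split)

lemma pderiv_map_pderiv: "pderiv (map_poly pderiv f) = map_poly pderiv (pderiv f)"
  by (rule poly_eqI)
    (simp add: coeff_map_poly coeff_pderiv of_nat_poly pderiv_smult del: of_nat_Suc)

lemma DERIV_ev_comp:
  assumes "(g has_real_derivative g') (at t)"
  shows "((\<lambda>t. ev f t (g t)) has_real_derivative
    ev (map_poly pderiv f) t (g t) + ev (pderiv f) t (g t) * g') (at t)"
proof (induction f)
  case (pCons c f)
  show ?case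
    by (rule derivative_eq_intros pCons.IH assms poly_DERIV refl
        | simp add: pderiv_pCons map_pderiv_pCons algebra_simps)+
qed simp

abbreviation "fib f x \<equiv> {y. ev f x y = 0}"

lemma ev_eq_poly: "ev f x y = poly (map_poly (\<lambda>c. poly c x) f) y"
  by (induction f) (simp_all add: map_poly_pCons)

text \<open>The nonzero leading coefficient keeps the specialization of \<open>f\<close> at
  \<open>x\<close> from being the zero polynomial.\<close>

lemma fib_finite_card:
  assumes "poly (lead_coeff f) x \<noteq> 0"
  shows "finite (fib f x)" "card (fib f x) \<le> degree f"
proof -
  let ?p = "map_poly (\<lambda>c. poly c x) f"
  have "coeff ?p (degree f) \<noteq> 0" using assms by (simp add: coeff_map_poly)
  then have nz: "?p \<noteq> 0" by auto
  then show "finite (fib f x)"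
    unfolding ev_eq_poly by (rule poly_roots_finite)
  have "card (fib f x) \<le> degree ?p"
    unfolding ev_eq_poly using nz by (rule card_poly_roots_bound)
  also have "\<dots> \<le> degree f" by (rule map_poly_degree_leq)
  finally show "card (fib f x) \<le> degree f" .
qed

section \<open>Local behaviour of simple roots\<close>

text \<open>The first condition keeps roots from escaping to infinity near \<open>x\<close>, the
  second keeps them from merging or disappearing.\<close>

definition simple_at :: "real poly poly \<Rightarrow> real \<Rightarrow> bool" where
  "simple_at f x \<longleftrightarrow> poly (lead_coeff f) x \<noteq> 0 \<and> (\<forall>y. ev f x y = 0 \<longrightarrow> ev (pderiv f) x y \<noteq> 0)"

text \<open>Isolate the leading term and divide by \<open>\<bar>y\<bar> ^ (n - 1)\<close>, which
  dominates all lower powers because \<open>\<bar>y\<bar> \<ge> 1\<close>.\<close>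

lemma root_bound:
  assumes "ev f x y = 0" "\<bar>y\<bar> \<ge> 1" "degree f > 0"
  shows "\<bar>poly (lead_coeff f) x\<bar> * \<bar>y\<bar> \<le> (\<Sum>i<degree f. \<bar>poly (coeff f i) x\<bar>)"
proof -
  define n where "n = degree f"
  have *: "ev f x y = (\<Sum>i\<le>n. poly (coeff f i) x * y ^ i)"
    by (simp add: ev_def poly_altdef[of f] poly_sum n_def)
  then have "poly (coeff f n) x * y ^ n = - (\<Sum>i<n. poly (coeff f i) x * y ^ i)"
    using assms(1) by (simp add: lessThan_Suc_atMost[symmetric])
  then have "\<bar>poly (coeff f n) x\<bar> * \<bar>y\<bar> ^ n = \<bar>\<Sum>i<n. poly (coeff f i) x * y ^ i\<bar>"
    by (metis abs_minus_cancel abs_mult power_abs)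
  also have "\<dots> \<le> (\<Sum>i<n. \<bar>poly (coeff f i) x * y ^ i\<bar>)" by (rule sum_abs)
  also have "\<dots> \<le> (\<Sum>i<n. \<bar>poly (coeff f i) x\<bar> * \<bar>y\<bar> ^ (n - 1))"
    using assms(2) by (intro sum_mono) (auto simp: abs_mult power_abs intro!: mult_left_mono power_increasing)
  also have "\<dots> = (\<Sum>i<n. \<bar>poly (coeff f i) x\<bar>) * \<bar>y\<bar> ^ (n - 1)"
    by (simp add: sum_distrib_right)
  finally have "(\<bar>poly (coeff f n) x\<bar> * \<bar>y\<bar>) * \<bar>y\<bar> ^ (n - 1) \<le> (\<Sum>i<n. \<bar>poly (coeff f i) x\<bar>) * \<bar>y\<bar> ^ (n - 1)"
    using assms(3) by (simp add: n_def mult.assoc flip: power_Suc)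
  then have "\<bar>poly (coeff f n) x\<bar> * \<bar>y\<bar> \<le> (\<Sum>i<n. \<bar>poly (coeff f i) x\<bar>)"
    by (rule mult_right_le_imp_le) (use assms(2) in auto)
  then show ?thesis by (simp add: n_def)
qed

text \<open>The root bound, as a quotient, is continuous at \<open>x0\<close>, so a slightly larger
  constant works nearby; roots of modulus below 1 are covered by \<open>max 1 M\<close>.\<close>

lemma roots_locally_bounded:
  assumes "poly (lead_coeff f) x0 \<noteq> 0"
  shows "\<exists>M. \<forall>\<^sub>F x in nhds x0. \<forall>y\<in>fib f x. \<bar>y\<bar> \<le> M"
proof (cases "degree f = 0")
  case True
  then obtain c where f: "f = [:c:]" by (metis degree_eq_zeroE)
  have "\<forall>\<^sub>F x in nhds x0. poly c x \<noteq> 0"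
    using assms f by (intro tendsto_imp_eventually_ne[where c = "poly c x0"] tendsto_intros filterlim_ident) auto
  then have "\<forall>\<^sub>F x in nhds x0. \<forall>y\<in>fib f x. \<bar>y\<bar> \<le> 0"
    by eventually_elim (simp add: f)
  then show ?thesis by blast
next
  case False
  let ?S = "\<lambda>x. \<Sum>i<degree f. \<bar>poly (coeff f i) x\<bar>"
  let ?l = "\<lambda>x. \<bar>poly (lead_coeff f) x\<bar>"
  define M where "M = ?S x0 / ?l x0 + 1"
  have "((\<lambda>x. ?S x / ?l x) \<longlongrightarrow> ?S x0 / ?l x0) (nhds x0)"
    using assms by (intro tendsto_intros filterlim_ident) auto
  then have "\<forall>\<^sub>F x in nhds x0. ?S x / ?l x < M"
    by (rule order_tendstoD) (simp add: M_def)
  moreover have "\<forall>\<^sub>F x in nhds x0. poly (lead_coeff f) x \<noteq> 0"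
    using assms by (intro tendsto_imp_eventually_ne[where c = "poly (lead_coeff f) x0"] tendsto_intros filterlim_ident) auto
  ultimately have "\<forall>\<^sub>F x in nhds x0. \<forall>y\<in>fib f x. \<bar>y\<bar> \<le> max 1 M"
  proof eventually_elim
    case (elim x)
    show ?case
    proof
      fix y assume y: "y \<in> fib f x"
      show "\<bar>y\<bar> \<le> max 1 M"
      proof (cases "\<bar>y\<bar> \<ge> 1")
        case True
        then have "?l x * \<bar>y\<bar> \<le> ?S x" using root_bound[of f x y] y False by simp
        then have "\<bar>y\<bar> \<le> ?S x / ?l x" using elim by (simp add: field_simps)
        with elim show ?thesis by simp
      qed simp
    qed
  qed
  then show ?thesis by blast
qed

text \<open>On a small rectangle the derivative in \<open>y\<close> keeps its sign, so
  \<open>f\<close> is strictly monotone in \<open>y\<close>. Opposite signs at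
  \<open>y0 - \<eta> / 2\<close> and \<open>y0 + \<eta> / 2\<close> persist for \<open>x\<close>
  near \<open>x0\<close>, and the intermediate value theorem gives the root. All small \<eta> are
  covered so that the windows can be shrunk later.\<close>

lemma root_locally_unique:
  assumes "ev f x0 y0 = 0" "ev (pderiv f) x0 y0 \<noteq> 0"
  shows "\<exists>\<eta>0>0. \<forall>\<eta>. 0 < \<eta> \<longrightarrow> \<eta> \<le> \<eta>0 \<longrightarrow> (\<forall>\<^sub>F x in nhds x0. \<exists>!y. ev f x y = 0 \<and> \<bar>y - y0\<bar> < \<eta>)"
proof -
  define s where "s = sgn (ev (pderiv f) x0 y0)"
  have s: "s \<noteq> 0" using assms by (simp add: s_def sgn_0_0)
  have "((\<lambda>z. s * ev (pderiv f) (fst z) (snd z)) \<longlongrightarrow>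
      s * ev (pderiv f) (fst (x0, y0)) (snd (x0, y0))) (nhds (x0, y0))"
    by (intro tendsto_intros filterlim_ident)
  moreover have "s * ev (pderiv f) x0 y0 > 0"
    using assms(2) by (auto simp: s_def sgn_if)
  ultimately have "\<forall>\<^sub>F z in nhds (x0, y0). s * ev (pderiv f) (fst z) (snd z) > 0"
    by (intro order_tendstoD(1)) auto
  then obtain A B where AB: "\<forall>\<^sub>F x in nhds x0. A x" "\<forall>\<^sub>F y in nhds y0. B y"
      "\<And>x y. A x \<Longrightarrow> B y \<Longrightarrow> s * ev (pderiv f) x y > 0"
    unfolding nhds_prod eventually_prod_filter by auto
  obtain e where e: "e > 0" "\<And>y. \<bar>y - y0\<bar> < e \<Longrightarrow> B y"
    using AB(2) by (auto simp: eventually_nhds_metric dist_real_def)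
  have mono: "s * ev f x a < s * ev f x b" if "A x" "a < b" "\<bar>a - y0\<bar> < e" "\<bar>b - y0\<bar> < e" for x a b
  proof (rule DERIV_pos_imp_increasing[OF \<open>a < b\<close>])
    fix y assume "a \<le> y" "y \<le> b"
    then have "s * ev (pderiv f) x y > 0" using that by (intro AB e) auto
    moreover have "((\<lambda>y. s * ev f x y) has_real_derivative s * ev (pderiv f) x y) (at y)"
      by (intro DERIV_cmult DERIV_ev_snd)
    ultimately show "\<exists>D. ((\<lambda>y. s * ev f x y) has_real_derivative D) (at y) \<and> 0 < D" by blast
  qed
  have A0: "A x0" using AB(1) by (rule eventually_nhds_x_imp_x)
  show ?thesis
  proof (intro exI[of _ "e"] conjI allI impI)
    fix \<eta> :: real assume \<eta>: "0 < \<eta>" "\<eta> \<le> e"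
    have "s * ev f x0 (y0 - \<eta> / 2) < 0" "s * ev f x0 (y0 + \<eta> / 2) > 0"
      using mono[OF A0, of "y0 - \<eta> / 2" y0] mono[OF A0, of y0 "y0 + \<eta> / 2"] \<eta> assms(1) by auto
    then have "\<forall>\<^sub>F x in nhds x0. s * ev f x (y0 - \<eta> / 2) < 0" "\<forall>\<^sub>F x in nhds x0. s * ev f x (y0 + \<eta> / 2) > 0"
      by (auto intro!: order_tendstoD tendsto_intros filterlim_ident)
    with AB(1) show "\<forall>\<^sub>F x in nhds x0. \<exists>!y. ev f x y = 0 \<and> \<bar>y - y0\<bar> < \<eta>"
    proof eventually_elim
      case (elim x)
      have "continuous_on {y0 - \<eta> / 2..y0 + \<eta> / 2} (\<lambda>y. s * ev f x y)"
        by (intro continuous_intros)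
      then obtain y where "y0 - \<eta> / 2 \<le> y" "y \<le> y0 + \<eta> / 2" "s * ev f x y = 0"
        using IVT'[of "\<lambda>y. s * ev f x y" "y0 - \<eta> / 2" 0 "y0 + \<eta> / 2"] elim \<eta> by auto
      then have y: "ev f x y = 0" "\<bar>y - y0\<bar> < \<eta>" using s \<eta> by auto
      show ?case
      proof (rule ex1I[of _ y])
        fix z assume z: "ev f x z = 0 \<and> \<bar>z - y0\<bar> < \<eta>"
        show "z = y"
          using mono[OF elim(1), of z y] mono[OF elim(1), of y z] z y \<eta> by (cases z y rule: linorder_cases) auto
      qed (use y in auto)
    qed
  qed (use e in auto)
qed

text \<open>The tube lemma for the open set where \<open>f\<close> does not vanish.\<close>

lemma eventually_no_root_on_compact:
  assumes "compact K" "\<And>y. y \<in> K \<Longrightarrow> ev f x0 y \<noteq> 0"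
  shows "\<forall>\<^sub>F x in nhds x0. \<forall>y\<in>K. ev f x y \<noteq> 0"
proof -
  let ?W = "{z :: real \<times> real. ev f (fst z) (snd z) \<noteq> 0}"
  have "open ?W"
    by (intro open_Collect_neq continuous_intros)
  then have "\<exists>U V. openin euclidean U \<and> openin euclidean V \<and> x0 \<in> U \<and> K \<subseteq> V \<and> U \<times> V \<subseteq> ?W"
    using assms by (intro tube_lemma_right) auto
  then show ?thesis
    by (auto simp: eventually_nhds subset_iff)
qed

text \<open>Around each root over \<open>x0\<close> lies a window containing exactly one root over
  nearby \<open>x\<close>. Any other root would lie in a fixed compact set that is free of roots
  over \<open>x0\<close>, hence also nearby; disjoint windows preserve the order.\<close>

lemma roots_move_continuously:
  assumes "simple_at f x0" "\<eta> > 0"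
  shows "\<forall>\<^sub>F x in nhds x0. \<exists>u. strict_mono_on (fib f x0) u \<and> u ` fib f x0 = fib f x \<and>
           (\<forall>y\<in>fib f x0. \<bar>u y - y\<bar> < \<eta>)"
proof -
  let ?R = "fib f x0"
  have lc: "poly (lead_coeff f) x0 \<noteq> 0" and simple: "\<And>y. y \<in> ?R \<Longrightarrow> ev (pderiv f) x0 y \<noteq> 0"
    using assms by (auto simp: simple_at_def)
  have fin: "finite ?R" using fib_finite_card(1)[OF lc] .
  have ev_small: "\<forall>\<^sub>F e in at_right 0. e \<le> c" if "c > 0" for c :: real
    using that unfolding eventually_at_right_field by (intro exI[of _ c]) auto
  have "\<forall>\<^sub>F e in at_right 0. \<forall>y\<in>?R. \<forall>\<^sub>F x in nhds x0. \<exists>!y'. ev f x y' = 0 \<and> \<bar>y' - y\<bar> < e"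
  proof (intro eventually_ball_finite fin ballI)
    fix y assume "y \<in> ?R"
    then obtain c where c: "c > 0" "\<And>e. 0 < e \<Longrightarrow> e \<le> c \<Longrightarrow> \<forall>\<^sub>F x in nhds x0. \<exists>!y'. ev f x y' = 0 \<and> \<bar>y' - y\<bar> < e"
      using root_locally_unique[of f x0 y] simple by blast
    show "\<forall>\<^sub>F e in at_right 0. \<forall>\<^sub>F x in nhds x0. \<exists>!y'. ev f x y' = 0 \<and> \<bar>y' - y\<bar> < e"
      using ev_small[OF c(1)] eventually_at_right_less[of 0] by eventually_elim (rule c(2))
  qed
  \<comment> \<open>Open windows of radius at most half of each gap are disjoint.\<close>
  moreover have "\<forall>\<^sub>F e in at_right 0. \<forall>y\<in>?R. \<forall>z\<in>?R. y < z \<longrightarrow> e \<le> (z - y) / 2"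
  proof (intro eventually_ball_finite fin ballI)
    fix y z :: real
    show "\<forall>\<^sub>F e in at_right 0. y < z \<longrightarrow> e \<le> (z - y) / 2"
      using ev_small[of "(z - y) / 2"] by (cases "y < z") simp_all
  qed
  moreover have "\<forall>\<^sub>F e in at_right 0. e \<le> \<eta>" using ev_small[OF assms(2)] .
  moreover have "\<forall>\<^sub>F e in at_right (0::real). e > 0" by (rule eventually_at_right_less)
  ultimately have "\<forall>\<^sub>F e in at_right 0. e > 0 \<and> e \<le> \<eta> \<and> (\<forall>y\<in>?R. \<forall>z\<in>?R. y < z \<longrightarrow> e \<le> (z - y) / 2) \<and>
      (\<forall>y\<in>?R. \<forall>\<^sub>F x in nhds x0. \<exists>!y'. ev f x y' = 0 \<and> \<bar>y' - y\<bar> < e)"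
    by eventually_elim auto
  then obtain e where e: "e > 0" "e \<le> \<eta>" "\<And>y z. y \<in> ?R \<Longrightarrow> z \<in> ?R \<Longrightarrow> y < z \<Longrightarrow> e \<le> (z - y) / 2"
      "\<forall>y\<in>?R. \<forall>\<^sub>F x in nhds x0. \<exists>!y'. ev f x y' = 0 \<and> \<bar>y' - y\<bar> < e"
    using eventually_happens'[OF trivial_limit_at_right_real] by blast
  obtain M where M: "\<forall>\<^sub>F x in nhds x0. \<forall>y\<in>fib f x. \<bar>y\<bar> \<le> M"
    using roots_locally_bounded[OF lc] by blast
  define K where "K = {-M..M} - (\<Union>y\<in>?R. ball y e)"
  have "compact K" unfolding K_def by (intro compact_diff) auto
  moreover have "ev f x0 y \<noteq> 0" if "y \<in> K" for y
    using that e(1) by (auto simp: K_def)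
  ultimately have "\<forall>\<^sub>F x in nhds x0. \<forall>y\<in>K. ev f x y \<noteq> 0"
    by (rule eventually_no_root_on_compact)
  moreover have "\<forall>\<^sub>F x in nhds x0. \<forall>y\<in>?R. \<exists>!y'. ev f x y' = 0 \<and> \<bar>y' - y\<bar> < e"
    using fin e(4) by (rule eventually_ball_finite)
  ultimately show ?thesis using M
  proof eventually_elim
    case (elim x)
    define u where "u y = (THE y'. ev f x y' = 0 \<and> \<bar>y' - y\<bar> < e)" for y
    have u: "ev f x (u y) = 0 \<and> \<bar>u y - y\<bar> < e" if "y \<in> ?R" for y
      unfolding u_def using bspec[OF elim(2) that] by (rule theI')
    have uniq: "z = u y" if "y \<in> ?R" "ev f x z = 0" "\<bar>z - y\<bar> < e" for y z
      using bspec[OF elim(2) that(1)] that(2,3) u[OF that(1)] by (elim ex1E) metis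
    have "strict_mono_on ?R u"
    proof (rule strict_mono_onI)
      fix y z assume yz: "y \<in> ?R" "z \<in> ?R" "y < z"
      then show "u y < u z" using conjunct2[OF u[OF yz(1)]] conjunct2[OF u[OF yz(2)]] e(3)[OF yz]
        unfolding abs_less_iff by simp
    qed
    moreover have "u ` ?R = fib f x"
    proof
      show "u ` ?R \<subseteq> fib f x" using u by auto
      show "fib f x \<subseteq> u ` ?R"
      proof
        fix z assume z: "z \<in> fib f x"
        then have "\<bar>z\<bar> \<le> M" "z \<notin> K" using elim by auto
        then obtain y where "y \<in> ?R" "\<bar>z - y\<bar> < e" by (auto simp: K_def dist_real_def abs_minus_commute)
        then show "z \<in> u ` ?R" using uniq z by blast
      qed
    qed
    moreover have "\<forall>y\<in>?R. \<bar>u y - y\<bar> < \<eta>" using less_le_trans[OF conjunct2[OF u] e(2)] by blast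
    ultimately show ?case by blast
  qed
qed

section \<open>Branches of the curve\<close>

text \<open>The label of a root; as a count of lower roots it survives any order-preserving motion
  of the fibre.\<close>

definition root_index :: "real poly poly \<Rightarrow> real \<Rightarrow> real \<Rightarrow> nat" where
  "root_index f x y = card {z \<in> fib f x. z < y}"

lemma root_index_inj:
  assumes "simple_at f x" "y \<in> fib f x" "z \<in> fib f x" "root_index f x y = root_index f x z"
  shows "y = z"
proof -
  have fin: "finite (fib f x)" using assms by (auto simp: simple_at_def intro: fib_finite_card)
  have "root_index f x a < root_index f x b" if "a \<in> fib f x" "a < b" for a b
    unfolding root_index_def using fin that by (intro psubset_card_mono) auto
  then show ?thesis using assms by (cases y z rule: linorder_cases) force+
qed

lemma root_index_le:
  assumes "simple_at f x"
  shows "root_index f x y \<le> degree f"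
proof -
  have "root_index f x y \<le> card (fib f x)"
    unfolding root_index_def using assms
    by (intro card_mono fib_finite_card) (auto simp: simple_at_def)
  also have "\<dots> \<le> degree f" using assms by (intro fib_finite_card) (auto simp: simple_at_def)
  finally show ?thesis .
qed

text \<open>An increasing bijection of fibres preserves the count of lower roots. Both directions
  are recorded: no label is lost nearby and none arises.\<close>

lemma root_index_locally_constant:
  assumes "simple_at f x0" "\<eta> > 0"
  shows "\<forall>\<^sub>F x in nhds x0.
    (\<forall>y0\<in>fib f x0. \<exists>y\<in>fib f x. root_index f x y = root_index f x0 y0 \<and> \<bar>y - y0\<bar> < \<eta>) \<and>
    (\<forall>y\<in>fib f x. \<exists>y0\<in>fib f x0. root_index f x y = root_index f x0 y0)"
  using roots_move_continuously[OF assms]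
proof eventually_elim
  case (elim x)
  then obtain u where u: "strict_mono_on (fib f x0) u" "u ` fib f x0 = fib f x"
    "\<forall>y\<in>fib f x0. \<bar>u y - y\<bar> < \<eta>" by blast
  have *: "root_index f x (u y) = root_index f x0 y" if y: "y \<in> fib f x0" for y
  proof -
    have "{z \<in> fib f x. z < u y} = u ` {z \<in> fib f x0. z < y}"
      using u(1) y by (auto simp: u(2)[symmetric] strict_mono_on_less)
    moreover have "inj_on u {z \<in> fib f x0. z < y}"
      using strict_mono_on_imp_inj_on[OF u(1)] by (rule inj_on_subset) auto
    ultimately show ?thesis by (simp add: root_index_def card_image)
  qed
  then have "\<exists>y\<in>u ` fib f x0. root_index f x y = root_index f x0 y0 \<and> \<bar>y - y0\<bar> < \<eta>"
    if "y0 \<in> fib f x0" for y0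
    using that u(3) by blast
  moreover have "\<exists>y0\<in>fib f x0. root_index f x y = root_index f x0 y0" if "y \<in> u ` fib f x0" for y
    using that * by blast
  ultimately show ?case unfolding u(2) by blast
qed

text \<open>Meaningful only where exactly one root has the label \<open>j\<close>; elsewhere the
  value is arbitrary.\<close>

definition branch :: "real poly poly \<Rightarrow> nat \<Rightarrow> real \<Rightarrow> real" where
  "branch f j x = (THE y. y \<in> fib f x \<and> root_index f x y = j)"

lemma branch_eq:
  assumes "simple_at f x" "y \<in> fib f x" "root_index f x y = j"
  shows "branch f j x = y"
  unfolding branch_def
proof (rule the_equality)
  fix z assume "z \<in> fib f x \<and> root_index f x z = j"
  then show "z = y" using root_index_inj[OF assms(1), of z y] assms(2,3) by simp
qed (use assms in simp)

text \<open>Having a root with label \<open>j\<close> is a locally constant property of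
  \<open>x\<close>, hence constant on the connected set \<open>S\<close>.\<close>

lemma branch_exists:
  assumes "connected S" "\<And>x. x \<in> S \<Longrightarrow> simple_at f x"
    and "x1 \<in> S" "y1 \<in> fib f x1" "root_index f x1 y1 = j" "x \<in> S"
  shows "branch f j x \<in> fib f x" "root_index f x (branch f j x) = j"
proof -
  let ?Q = "\<lambda>x. \<exists>y\<in>fib f x. root_index f x y = j"
  have "?Q x1 = ?Q x"
  proof (rule connected_local_const[where f = ?Q, OF assms(1,3,6)], intro ballI)
    fix a assume "a \<in> S"
    have "\<forall>\<^sub>F b in nhds a. ?Q a = ?Q b"
      using root_index_locally_constant[OF assms(2)[OF \<open>a \<in> S\<close>] zero_less_one]
    proof eventually_elim
      case (elim b)
      show ?case
      proof
        assume "?Q a"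
        then obtain y0 where "y0 \<in> fib f a" "root_index f a y0 = j" by blast
        moreover from this obtain y where "y \<in> fib f b" "root_index f b y = root_index f a y0"
          using conjunct1[OF elim] by blast
        ultimately show "?Q b" by auto
      next
        assume "?Q b"
        then obtain y where "y \<in> fib f b" "root_index f b y = j" by blast
        moreover from this obtain y0 where "y0 \<in> fib f a" "root_index f b y = root_index f a y0"
          using conjunct2[OF elim] by blast
        ultimately show "?Q a" by auto
      qed
    qed
    then show "\<forall>\<^sub>F b in at a within S. ?Q a = ?Q b"
      by (rule filter_leD[OF at_within_le_nhds])
  qed
  then obtain y where "y \<in> fib f x" "root_index f x y = j" using assms by blast
  with branch_eq[OF assms(2)[OF assms(6)] this]
  show "branch f j x \<in> fib f x" "root_index f x (branch f j x) = j" by auto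
qed

text \<open>A root with label \<open>j\<close> close to the old one must be the value of the branch,
  since labels determine roots; arbitrarily small distances give continuity.\<close>

lemma branch_locally:
  assumes U: "open U" "\<And>x. x \<in> U \<Longrightarrow> simple_at f x"
    and x0: "x0 \<in> U" "branch f j x0 \<in> fib f x0" "root_index f x0 (branch f j x0) = j"
  shows "isCont (branch f j) x0" "\<forall>\<^sub>F x in nhds x0. x \<in> U \<and> branch f j x \<in> fib f x \<and> root_index f x (branch f j x) = j"
proof -
  have nearU: "\<forall>\<^sub>F x in nhds x0. x \<in> U" using U(1) x0(1) by (rule eventually_nhds_in_open)
  have *: "\<forall>\<^sub>F x in nhds x0. x \<in> U \<and> \<bar>branch f j x - branch f j x0\<bar> < \<eta> \<and>
      branch f j x \<in> fib f x \<and> root_index f x (branch f j x) = j" if "\<eta> > 0" for \<eta>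
    using root_index_locally_constant[OF U(2)[OF x0(1)] that] nearU
  proof eventually_elim
    case (elim x)
    obtain y where "y \<in> fib f x" "root_index f x y = j" "\<bar>y - branch f j x0\<bar> < \<eta>"
      using bspec[OF conjunct1[OF elim(1)] x0(2)] unfolding x0(3) by (elim bexE conjE)
    moreover from this have "branch f j x = y" by (intro branch_eq U(2) elim)
    ultimately show ?case using elim by simp
  qed
  show "\<forall>\<^sub>F x in nhds x0. x \<in> U \<and> branch f j x \<in> fib f x \<and> root_index f x (branch f j x) = j"
    by (rule eventually_mono[OF *[of 1]]) auto
  have "(branch f j \<longlongrightarrow> branch f j x0) (nhds x0)"
  proof (rule tendstoI)
    fix e :: real assume "e > 0"
    from *[OF this] show "\<forall>\<^sub>F x in nhds x0. dist (branch f j x) (branch f j x0) < e"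
      by (rule eventually_mono) (simp add: dist_real_def)
  qed
  then show "isCont (branch f j) x0"
    unfolding isCont_def by (rule tendsto_mono[OF at_within_le_nhds])
qed

text \<open>
  Dividing \<open>f\<close> by \<open>y - g x0\<close> turns the equation \<open>f (x, g x) = 0\<close> into an explicit formula for
  \<open>g x - g x0\<close>, so no mean value theorem in two variables is needed.
\<close>

lemma implicit_derivative:
  assumes cont: "isCont g x0" and zero: "\<forall>\<^sub>F x in nhds x0. ev f x (g x) = 0"
    and simple: "ev (pderiv f) x0 (g x0) \<noteq> 0"
  shows "(g has_real_derivative - ev (map_poly pderiv f) x0 (g x0) / ev (pderiv f) x0 (g x0)) (at x0)"
proof -
  define y0 where "y0 = g x0"
  define q where "q = synthetic_div f [:y0:]"
  have f: "f = [:- [:y0:], 1:] * q + [:poly f [:y0:]:]"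
    unfolding q_def by (rule synthetic_div_correct'[symmetric])
  have split: "ev f x y = (y - y0) * ev q x y + ev f x y0" for x y
    by (subst f) (simp add: ev_def algebra_simps)
  \<comment> \<open>Product rule in \<open>y\<close>; at \<open>y = y0\<close> only the summand
    \<open>q\<close> survives.\<close>
  have "pderiv f = [:- [:y0:], 1:] * pderiv q + q"
    by (subst f) (simp add: pderiv_add pderiv_mult pderiv_pCons pderiv_smult)
  then have "ev (pderiv f) x0 y0 = ev ([:- [:y0:], 1:] * pderiv q + q) x0 y0"
    by (simp only:)
  then have q0: "ev q x0 y0 = ev (pderiv f) x0 y0"
    by (simp add: ev_def)
  have tq: "((\<lambda>x. ev q x (g x)) \<longlongrightarrow> ev q x0 y0) (at x0)"
    using cont by (intro tendsto_ev tendsto_ident_at) (simp add: isCont_def y0_def)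
  have zero0: "ev f x0 y0 = 0"
    using eventually_nhds_x_imp_x[OF zero] by (simp add: y0_def)
  have "((\<lambda>x. ev f x y0) has_real_derivative ev (map_poly pderiv f) x0 y0) (at x0)"
    using DERIV_ev_comp[of "\<lambda>_. y0" 0 x0 f] by simp
  then have A: "((\<lambda>x. ev f x y0 / (x - x0)) \<longlongrightarrow> ev (map_poly pderiv f) x0 y0) (at x0)"
    by (simp add: has_field_derivative_iff zero0)
  have q_nz: "ev q x0 y0 \<noteq> 0" by (metis q0 simple y0_def)
  have "((\<lambda>x. - (ev f x y0 / (x - x0)) / ev q x (g x)) \<longlongrightarrow>
      - ev (map_poly pderiv f) x0 y0 / ev q x0 y0) (at x0)"
    by (rule tendsto_divide[OF tendsto_minus[OF A] tq q_nz])
  moreover have "\<forall>\<^sub>F x in at x0. - (ev f x y0 / (x - x0)) / ev q x (g x) = (g x - g x0) / (x - x0)"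
  proof -
    have "\<forall>\<^sub>F x in at x0. ev q x (g x) \<noteq> 0"
      using tq q_nz by (rule tendsto_imp_eventually_ne)
    moreover have "\<forall>\<^sub>F x in at x0. ev f x (g x) = 0"
      using zero by (rule filter_leD[OF at_within_le_nhds])
    ultimately show ?thesis
    proof eventually_elim
      case (elim x)
      have "(g x - y0) * ev q x (g x) + ev f x y0 = 0"
        using split[of x "g x"] elim(2) by (simp only:)
      then have "ev f x y0 = - ((g x - y0) * ev q x (g x))" by linarith
      then show ?case using elim(1) by (simp add: y0_def)
    qed
  qed
  ultimately have "((\<lambda>x. (g x - g x0) / (x - x0)) \<longlongrightarrow> - ev (map_poly pderiv f) x0 y0 / ev q x0 y0) (at x0)"
    by (rule Lim_transform_eventually)
  then show ?thesis
    unfolding has_field_derivative_iff q0 by (simp only: y0_def)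
qed

lemma ev_numeral: "ev (numeral n) x y = numeral n"
  by (simp add: ev_def)

text \<open>The quotient rule for the implicit slope \<open>m\<close>; inserting the slope for the
  derivative of \<open>g\<close> turns the numerator into \<open>- hess f\<close>, up to a power of
  \<open>pderiv f\<close>.\<close>

lemma implicit_second_derivative:
  fixes f :: "real poly poly"
  defines "X \<equiv> map_poly pderiv"
  defines "m \<equiv> \<lambda>g x. - ev (X f) x (g x) / ev (pderiv f) x (g x)"
  assumes g: "(g has_real_derivative m g x) (at x)" and nz: "ev (pderiv f) x (g x) \<noteq> 0"
  shows "(m g has_real_derivative - ev (hess f) x (g x) / ev (pderiv f) x (g x) ^ 3) (at x)"
proof -
  let ?a = "ev (X f) x (g x)" and ?b = "ev (pderiv f) x (g x)"
  let ?A = "ev (X (X f)) x (g x) + ev (X (pderiv f)) x (g x) * m g x"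
  let ?B = "ev (X (pderiv f)) x (g x) + ev (pderiv (pderiv f)) x (g x) * m g x"
  have "((\<lambda>x. ev (X f) x (g x)) has_real_derivative ?A) (at x)"
    using DERIV_ev_comp[OF g, of "X f"] by (simp add: X_def pderiv_map_pderiv)
  moreover have "((\<lambda>x. ev (pderiv f) x (g x)) has_real_derivative ?B) (at x)"
    using DERIV_ev_comp[OF g, of "pderiv f"] by (simp add: X_def)
  ultimately have "(m g has_real_derivative (- ?A * ?b - - ?a * ?B) / (?b * ?b)) (at x)"
    unfolding m_def using nz by (intro DERIV_divide DERIV_minus) auto
  \<comment> \<open>Here \<open>p, r, t\<close> stand for the second derivatives in
    \<open>xx\<close>, \<open>xy\<close>, \<open>yy\<close>, while \<open>a, b\<close> are the first
    ones in \<open>x\<close>, \<open>y\<close> and \<open>u\<close> is the slope.\<close>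
  moreover have eq: "(- (p + r * u) * b - - a * (r + t * u)) / (b * b) =
      - (p * b\<^sup>2 - 2 * r * a * b + t * a\<^sup>2) / b ^ 3" if "b \<noteq> 0" "a = - (u * b)" for p r t a b u :: real
  proof -
    have "- (p + r * u) * b - - a * (r + t * u) = - (p + 2 * r * u + t * u\<^sup>2) * b"
      "- (p * b\<^sup>2 - 2 * r * a * b + t * a\<^sup>2) = - (p + 2 * r * u + t * u\<^sup>2) * b\<^sup>2"
      unfolding that(2) by (simp_all add: power2_eq_square algebra_simps)
    then show ?thesis using that(1) by (simp add: power2_eq_square power3_eq_cube)
  qed
  moreover have "?a = - (m g x * ?b)" using nz by (simp add: m_def)
  ultimately have "(m g has_real_derivative
      - (ev (X (X f)) x (g x) * ?b\<^sup>2 - 2 * ev (X (pderiv f)) x (g x) * ?a * ?b +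
        ev (pderiv (pderiv f)) x (g x) * ?a\<^sup>2) / ?b ^ 3) (at x)"
    using eq[OF nz, of ?a "m g x"] by (simp only:)
  then show ?thesis
    unfolding hess_def X_def[symmetric] ev_simps ev_numeral .
qed

text \<open>The expression is the orientation of three points of the graph of \<open>g\<close>, a
  positive multiple of the difference of two successive chord slopes. The mean value theorem for
  each chord and then for \<open>m\<close> yields the second derivative.\<close>

lemma orient_second_derivative:
  fixes g m m' :: "real \<Rightarrow> real"
  assumes "a < b" "b < c"
    and g: "\<And>x. a \<le> x \<Longrightarrow> x \<le> c \<Longrightarrow> (g has_real_derivative m x) (at x)"
    and m: "\<And>x. a \<le> x \<Longrightarrow> x \<le> c \<Longrightarrow> (m has_real_derivative m' x) (at x)"
  obtains t \<xi> where "t > 0" "a \<le> \<xi>" "\<xi> \<le> c"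
    "(b - a) * (g c - g a) - (g b - g a) * (c - a) = t * m' \<xi>"
proof -
  obtain x where x: "a < x" "x < b" "g b - g a = (b - a) * m x"
    using MVT2[OF \<open>a < b\<close>, of g m] g assms by force
  obtain y where y: "b < y" "y < c" "g c - g b = (c - b) * m y"
    using MVT2[OF \<open>b < c\<close>, of g m] g assms by force
  have "x < y" using x y by simp
  then obtain z where z: "x < z" "z < y" "m y - m x = (y - x) * m' z"
    using MVT2[of x y m m'] m x y by force
  have "(b - a) * (g c - g a) - (g b - g a) * (c - a) = (b - a) * (g c - g b) - (g b - g a) * (c - b)"
    by algebra
  also have "\<dots> = (b - a) * (c - b) * (m y - m x)"
    by (simp only: x(3) y(3)) algebra
  also have "\<dots> = (b - a) * (c - b) * (y - x) * m' z"
    by (simp only: z(3) mult.assoc)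
  finally show thesis
    using x y z assms(1,2) by (intro that[of "(b - a) * (c - b) * (y - x)" z]) auto
qed

text \<open>If \<open>f\<close> divides \<open>hess f\<close>, the second derivative of the branch
  is zero and its slope constant. Otherwise the second derivative has no zero on the interval and,
  being continuous, keeps one sign, so all triples of points turn the same way.\<close>

lemma branch_affine_or_strictly_convex:
  assumes simple: "\<And>x. poly P x \<noteq> 0 \<Longrightarrow> simple_at f x"
    and hess: "f dvd hess f \<or> (\<forall>x y. poly P x \<noteq> 0 \<longrightarrow> ev f x y = 0 \<longrightarrow> ev (hess f) x y \<noteq> 0)"
    and P: "\<And>x. a \<le> x \<Longrightarrow> x \<le> b \<Longrightarrow> poly P x \<noteq> 0"
    and root: "a \<le> x1" "x1 \<le> b" "y1 \<in> fib f x1" "root_index f x1 y1 = j"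
  defines "G \<equiv> branch f j"
  shows "(\<exists>c. \<forall>x y. a \<le> x \<longrightarrow> x < y \<longrightarrow> y \<le> b \<longrightarrow> G y - G x = c * (y - x)) \<or>
    (\<exists>\<sigma>. \<forall>x y z. a \<le> x \<longrightarrow> x < y \<longrightarrow> y < z \<longrightarrow> z \<le> b \<longrightarrow>
      \<sigma> * ((y - x) * (G z - G x) - (G y - G x) * (z - x)) > 0)"
proof -
  define m where "m x = - ev (map_poly pderiv f) x (G x) / ev (pderiv f) x (G x)" for x
  define m' where "m' x = - ev (hess f) x (G x) / ev (pderiv f) x (G x) ^ 3" for x
  have in_fib: "G x \<in> fib f x" "root_index f x (G x) = j" if "a \<le> x" "x \<le> b" for x
    using branch_exists[of "{a..b}" f x1 y1 j x] root that simple P unfolding G_def by auto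
  \<comment> \<open>The ends \<open>a\<close> and \<open>b\<close> need two-sided derivatives too,
    so the local results are applied on this open set.\<close>
  have openP: "open {x. poly P x \<noteq> 0}"
    by (intro open_Collect_neq continuous_intros)
  have cont: "isCont G x" and zero: "\<forall>\<^sub>F x in nhds x. ev f x (G x) = 0" if "a \<le> x" "x \<le> b" for x
  proof -
    have *: "x \<in> {x. poly P x \<noteq> 0}" "branch f j x \<in> fib f x" "root_index f x (branch f j x) = j"
      using P[OF that] in_fib[OF that] by (simp_all add: G_def)
    have s: "simple_at f x" if "x \<in> {x. poly P x \<noteq> 0}" for x
      using that simple by simp
    show "isCont G x" unfolding G_def by (rule branch_locally(1)[OF openP s *])
    show "\<forall>\<^sub>F x in nhds x. ev f x (G x) = 0"
      unfolding G_def by (rule eventually_mono[OF branch_locally(2)[OF openP s *]]) auto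
  qed
  have nz: "ev (pderiv f) x (G x) \<noteq> 0" if "a \<le> x" "x \<le> b" for x
    using in_fib(1)[OF that] simple[OF P[OF that]] by (simp add: simple_at_def)
  have DG: "(G has_real_derivative m x) (at x)" if "a \<le> x" "x \<le> b" for x
    unfolding m_def using cont[OF that] zero[OF that] nz[OF that] by (rule implicit_derivative)
  have Dm: "(m has_real_derivative m' x) (at x)" if "a \<le> x" "x \<le> b" for x
    using implicit_second_derivative[OF DG[OF that, unfolded m_def] nz[OF that]]
    unfolding m_def[symmetric] m'_def .
  from hess show ?thesis
  proof
    assume "f dvd hess f"
    then have m'0: "m' x = 0" if "a \<le> x" "x \<le> b" for x
      using ev_dvd[of f "hess f" x "G x"] in_fib(1)[OF that] by (simp add: m'_def)
    have m_const: "m x = m a" if "a \<le> x" "x \<le> b" for x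
    proof (cases "a = x")
      case False
      with that have "a < x" by simp
      moreover have "(m has_real_derivative m' w) (at w)" if "a \<le> w" "w \<le> x" for w
        using Dm that \<open>x \<le> b\<close> by simp
      ultimately obtain z where "a < z" "z < x" "m x - m a = (x - a) * m' z"
        using MVT2[of a x m m'] by blast
      then show ?thesis using m'0[of z] that by simp
    qed simp
    have "G y - G x = m a * (y - x)" if xy: "a \<le> x" "x < y" "y \<le> b" for x y
    proof -
      have "(G has_real_derivative m w) (at w)" if "x \<le> w" "w \<le> y" for w
        using DG that xy by simp
      then obtain z where "x < z" "z < y" "G y - G x = (y - x) * m z"
        using MVT2[OF xy(2), of G m] by blast
      then show ?thesis using m_const[of z] xy by simp
    qed
    then show ?thesis by blast
  next
    assume h: "\<forall>x y. poly P x \<noteq> 0 \<longrightarrow> ev f x y = 0 \<longrightarrow> ev (hess f) x y \<noteq> 0"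
    have m'_nz: "m' x \<noteq> 0" if "a \<le> x" "x \<le> b" for x
      using h P[OF that] in_fib(1)[OF that] nz[OF that] by (simp add: m'_def)
    have ab: "a \<le> b" using root by simp
    have contG: "continuous_on {a..b} G"
      by (rule continuous_at_imp_continuous_on) (use cont in auto)
    define \<sigma> where "\<sigma> = sgn (m' a)"
    have contm: "continuous_on {a..x} (\<lambda>x. \<sigma> * m' x)" if "x \<le> b" for x
      unfolding m'_def using continuous_on_subset[OF contG, of "{a..x}"] nz that
      by (intro continuous_intros) auto
    have pos: "\<sigma> * m' x > 0" if x: "a \<le> x" "x \<le> b" for x
    proof (rule ccontr)
      assume "\<not> ?thesis"
      moreover have "\<sigma> * m' a > 0" using m'_nz[of a] ab by (auto simp: \<sigma>_def sgn_if)
      ultimately obtain z where "a \<le> z" "z \<le> x" "\<sigma> * m' z = 0"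
        using IVT2'[of "\<lambda>x. \<sigma> * m' x" x 0 a] contm[OF x(2)] x by auto
      moreover have "\<sigma> \<noteq> 0" using m'_nz[of a] ab by (simp add: \<sigma>_def sgn_0_0)
      ultimately show False using m'_nz[of z] x by simp
    qed
    have "\<sigma> * ((y - x) * (G z - G x) - (G y - G x) * (z - x)) > 0"
      if xyz: "a \<le> x" "x < y" "y < z" "z \<le> b" for x y z
    proof -
      have "(G has_real_derivative m w) (at w)" "(m has_real_derivative m' w) (at w)"
        if "x \<le> w" "w \<le> z" for w
        using DG Dm that xyz by simp_all
      then obtain t w where "t > 0" "x \<le> w" "w \<le> z"
        "(y - x) * (G z - G x) - (G y - G x) * (z - x) = t * m' w"
        using orient_second_derivative[OF xyz(2,3), of G m m'] by metis
      moreover have "t * (\<sigma> * m' w) > 0" using calculation pos[of w] xyz by simp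
      ultimately show ?thesis by (simp add: mult.left_commute)
    qed
    then show ?thesis by blast
  qed
qed

text \<open>The hypotheses place \<open>T\<close> on a single branch over an interval free of zeros
  of \<open>P\<close>, and that branch is affine or strictly convex or concave.\<close>

lemma collinear_or_convex_chain:
  assumes simple: "\<And>x. poly P x \<noteq> 0 \<Longrightarrow> simple_at f x"
    and hess: "f dvd hess f \<or> (\<forall>x y. poly P x \<noteq> 0 \<longrightarrow> ev f x y = 0 \<longrightarrow> ev (hess f) x y \<noteq> 0)"
    and T: "finite T" "T \<noteq> {}" "\<And>p. p \<in> T \<Longrightarrow> ev f (p $ 1) (p $ 2) = 0"
      "\<And>p. p \<in> T \<Longrightarrow> root_index f (p $ 1) (p $ 2) = j"
    and P: "\<And>p q x. p \<in> T \<Longrightarrow> q \<in> T \<Longrightarrow> p $ 1 \<le> x \<Longrightarrow> x \<le> q $ 1 \<Longrightarrow> poly P x \<noteq> 0"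
  shows "collinear T \<or> (\<exists>\<sigma> p. convex_chain \<sigma> (card T) p \<and> p ` {..<card T} = T)"
proof -
  define X where "X = (\<lambda>p. p $ 1) ` T"
  define G where "G = branch f j"
  have X: "finite X" "X \<noteq> {}" using T by (auto simp: X_def)
  have bounds: "Min X \<le> p $ 1" "p $ 1 \<le> Max X" if "p \<in> T" for p
    using that X(1) by (auto simp: X_def)
  have Pint: "poly P x \<noteq> 0" if "Min X \<le> x" "x \<le> Max X" for x
    using Min_in[OF X] Max_in[OF X] P that unfolding X_def by fastforce
  have G: "p $ 2 = G (p $ 1)" if "p \<in> T" for p
    unfolding G_def using branch_eq[of f "p $ 1" "p $ 2" j] simple[OF P[OF that that]] T that by simp
  obtain p1 where p1: "p1 \<in> T" using T by blast
  note dichotomy = branch_affine_or_strictly_convex[OF simple hess Pint bounds[OF p1],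
      of "p1 $ 2" j, folded G_def]
  then consider c where "\<And>x y. Min X \<le> x \<Longrightarrow> x < y \<Longrightarrow> y \<le> Max X \<Longrightarrow> G y - G x = c * (y - x)"
    | \<sigma> where "\<And>x y z. Min X \<le> x \<Longrightarrow> x < y \<Longrightarrow> y < z \<Longrightarrow> z \<le> Max X \<Longrightarrow>
      \<sigma> * ((y - x) * (G z - G x) - (G y - G x) * (z - x)) > 0"
    using T(3,4)[OF p1] by blast
  then show ?thesis
  proof cases
    case (1 c)
    have "p - q = (p $ 1 - q $ 1) *\<^sub>R vector [1, c]" if "p \<in> T" "q \<in> T" for p q
    proof -
      have "G (p $ 1) - G (q $ 1) = c * (p $ 1 - q $ 1)"
        using 1[of "p $ 1" "q $ 1"] 1[of "q $ 1" "p $ 1"] bounds that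
        by (cases "p $ 1" "q $ 1" rule: linorder_cases) (force simp: algebra_simps)+
      then show ?thesis using G that by (simp add: vec_eq_iff forall_2)
    qed
    then have "collinear T" unfolding collinear_def by blast
    then show ?thesis ..
  next
    case (2 \<sigma>)
    \<comment> \<open>A graph has one point per abscissa, so sorting the abscissae enumerates
      \<open>T\<close> from left to right.\<close>
    define xs where "xs = sorted_list_of_set X"
    define p :: "nat \<Rightarrow> real ^ 2" where "p i = vector [xs ! i, G (xs ! i)]" for i
    have inj: "inj_on (\<lambda>p. p $ 1) T"
      using G by (intro inj_onI) (simp add: vec_eq_iff forall_2)
    have len: "length xs = card T"
      using card_image[OF inj] by (simp add: xs_def X_def)
    have set: "set xs = X" using X by (simp add: xs_def)
    have less: "xs ! i < xs ! k" if "i < k" "k < card T" for i k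
      using sorted_wrt_nth_less[OF strict_sorted_list_of_set[of X]] that len by (simp add: xs_def)
    have in_X: "Min X \<le> xs ! i" "xs ! i \<le> Max X" if "i < card T" for i
      using that len set X(1) nth_mem[of i xs] by auto
    have "convex_chain \<sigma> (card T) p"
      unfolding convex_chain_def
    proof (intro conjI allI impI)
      fix i k assume "i < k" "k < card T"
      then show "p i $ 1 < p k $ 1" using less by (simp add: p_def)
    next
      fix i k n assume "i < k" "k < n" "n < card T"
      then show "\<sigma> * orient (p i) (p k) (p n) > 0"
        using 2[of "xs ! i" "xs ! k" "xs ! n"] less in_X by (simp add: p_def orient_def)
    qed
    moreover have "p ` {..<card T} = T"
    proof -
      have "p ` {..<card T} = (\<lambda>x. vector [x, G x]) ` set xs"
        unfolding p_def set_conv_nth len[symmetric] by auto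
      also have "\<dots> = (\<lambda>q. vector [q $ 1, G (q $ 1)]) ` T"
        by (simp add: set X_def image_image)
      also have "\<dots> = (\<lambda>q. q) ` T"
        using G by (intro image_cong) (simp_all add: vec_eq_iff forall_2)
      finally show ?thesis by simp
    qed
    ultimately show ?thesis by blast
  qed
qed

section \<open>Visible points on an irreducible curve\<close>

text \<open>\<open>no_k_collinear\<close> speaks of exactly \<open>k\<close> points, so a larger
  collinear set is cut down to \<open>k\<close>.\<close>

lemma card_collinear_less:
  assumes "no_k_collinear k A" "S \<subseteq> A" "collinear S" 
  shows "card S < k"
proof (rule ccontr)
  assume "\<not> ?thesis"
  then obtain S' where "S' \<subseteq> S" "card S' = k"
    using obtain_subset_with_card_n[of k S] by auto
  then show False
    using assms collinear_subset[of S S'] by (auto simp: no_k_collinear_def)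
qed

lemma collinear_vertical: "collinear {p :: real ^ 2. p $ 1 = z}"
proof -
  have "p - q = (p $ 2 - q $ 2) *\<^sub>R vector [0, 1]" if "p $ 1 = q $ 1" for p q :: "real ^ 2"
    using that by (simp add: vec_eq_iff forall_2)
  then show ?thesis unfolding collinear_def by (metis (mono_tags, lifting) mem_Collect_eq)
qed

theorem theorem9p2:
  fixes d k l :: nat
  assumes "d \<ge> 1" and "k \<ge> 2" and "l \<ge> 2"
  shows "\<exists>\<epsilon>::real. \<epsilon> > 0 \<and> (\<exists>N0::nat. \<forall>(C :: (real ^ 2) set) (A :: (real ^ 2) set).
           irreducible_curve_deg_le d C \<longrightarrow>
           finite A \<longrightarrow>
           no_k_collinear k A \<longrightarrow>
           card (A \<inter> C) \<ge> N0 \<longrightarrow>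
           real (card (A - C)) \<le> \<epsilon> * real (card (A \<inter> C)) \<longrightarrow>
           (\<exists>S. card S = l \<and> mutually_visible A S))"
proof -
  obtain D where D: "\<And>f. irreducible f \<Longrightarrow> total_degree f \<le> d \<Longrightarrow>
     \<exists>P. P \<noteq> 0 \<and> degree P \<le> D \<and>
       (\<forall>x. poly P x \<noteq> 0 \<longrightarrow> poly (lead_coeff f) x \<noteq> 0) \<and>
       (\<forall>x y. poly P x \<noteq> 0 \<longrightarrow> ev f x y = 0 \<longrightarrow> ev (pderiv f) x y \<noteq> 0) \<and>
       (f dvd hess f \<or> (\<forall>x y. poly P x \<noteq> 0 \<longrightarrow> ev f x y = 0 \<longrightarrow> ev (hess f) x y \<noteq> 0))"
    using discriminant_exists[of d] by blast
  \<comment> \<open>The number of classes: at most \<open>D + 1\<close> intervals between zeros of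
    \<open>P\<close>, and labels from 0 to \<open>d\<close>.\<close>
  define K where "K = (D + 1) * (d + 1)"
  have "l \<ge> 1" using assms(3) by simp
  \<comment> \<open>The factor 4 combines two losses of at most half: points of \<open>A\<close> off
    the curve, and points on vertical lines over zeros of \<open>P\<close>.\<close>
  then obtain m0 where m0: "\<And>m \<sigma> p A. m0 \<le> m \<Longrightarrow> convex_chain \<sigma> m p \<Longrightarrow> finite A \<Longrightarrow>
      p ` {..<m} \<subseteq> A \<Longrightarrow> card A \<le> 4 * K * m \<Longrightarrow> \<exists>S. card S = l \<and> mutually_visible A S"
    using convex_chain_visible_subset[of l "4 * K"] by blast
  \<comment> \<open>The first summand keeps at least half of \<open>A \<inter> C\<close> off those
    vertical lines; the second makes some class larger than \<open>m0 + k\<close>.\<close>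
  define N0 where "N0 = 2 * (D * k) + 2 * K * (m0 + k) + 1"
  show ?thesis
  \<comment> \<open>With \<epsilon> = 1 the set \<open>A\<close> has at most twice as many points as
    \<open>A \<inter> C\<close>.\<close>
  proof (intro exI[of _ "1 :: real"] conjI exI[of _ N0] allI impI)
    fix C A :: "(real ^ 2) set"
    assume C: "irreducible_curve_deg_le d C" and A: "finite A" and k: "no_k_collinear k A"
      and N0: "card (A \<inter> C) \<ge> N0" and few: "real (card (A - C)) \<le> 1 * real (card (A \<inter> C))"
    obtain f where f: "irreducible f" "total_degree f \<le> d" "C = {p. eval2 f p = 0}"
      using C by (auto simp: irreducible_curve_deg_le_def)
    obtain P where P: "P \<noteq> 0" "degree P \<le> D"
      "\<And>x. poly P x \<noteq> 0 \<Longrightarrow> poly (lead_coeff f) x \<noteq> 0"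
      "\<And>x y. poly P x \<noteq> 0 \<Longrightarrow> ev f x y = 0 \<Longrightarrow> ev (pderiv f) x y \<noteq> 0"
      "f dvd hess f \<or> (\<forall>x y. poly P x \<noteq> 0 \<longrightarrow> ev f x y = 0 \<longrightarrow> ev (hess f) x y \<noteq> 0)"
      using D[OF f(1,2)] by blast
    have simple: "simple_at f x" if "poly P x \<noteq> 0" for x
      using P(3,4) that by (simp add: simple_at_def)
    define Z where "Z = {z. poly P z = 0}"
    have Z: "finite Z" "card Z \<le> D"
      using poly_roots_finite[OF P(1)] card_poly_roots_bound[OF P(1)] P(2) by (simp_all add: Z_def)
    define X where "X = {p \<in> A \<inter> C. poly P (p $ 1) \<noteq> 0}"
    have finX: "finite X" using A by (simp add: X_def)
    have vertical: "card (A \<inter> {p. p $ 1 = z}) < k" for z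
      by (intro card_collinear_less[OF k] collinear_subset[OF collinear_vertical[of z]]) auto
    \<comment> \<open>Each discarded point lies on one of at most \<open>D\<close> vertical lines,
      and such a line carries fewer than \<open>k\<close> points of \<open>A\<close>.\<close>
    have "card (A \<inter> C - X) \<le> card (\<Union>z\<in>Z. A \<inter> {p. p $ 1 = z})"
      using A Z by (intro card_mono) (auto simp: X_def Z_def)
    also have "\<dots> \<le> (\<Sum>z\<in>Z. card (A \<inter> {p. p $ 1 = z}))"
      using Z(1) by (rule card_UN_le)
    also have "\<dots> \<le> (\<Sum>z\<in>Z. k)"
      by (intro sum_mono less_imp_le vertical)
    also have "\<dots> \<le> D * k" using Z(2) by simp
    finally have "card (A \<inter> C - X) \<le> D * k" .
    moreover have "card (A \<inter> C) = card X + card (A \<inter> C - X)"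
      using A by (subst card_Un_disjoint[symmetric]) (auto simp: X_def intro!: arg_cong[of _ _ card])
    ultimately have cardX: "card (A \<inter> C) \<le> 2 * card X" "K * (m0 + k) < card X"
      using N0 by (simp_all add: N0_def)
    \<comment> \<open>On \<open>X\<close>, equal values of \<kappa> mean the same interval between
      zeros of \<open>P\<close> and the same branch over it.\<close>
    define \<kappa> where "\<kappa> p = (card {z \<in> Z. z < p $ 1}, root_index f (p $ 1) (p $ 2))" for p :: "real ^ 2"
    have "\<kappa> p \<in> {..D} \<times> {..d}" if "p \<in> X" for p
    proof -
      have "card {z \<in> Z. z < p $ 1} \<le> D"
        using card_mono[of Z "{z \<in> Z. z < p $ 1}"] Z by auto
      moreover have "root_index f (p $ 1) (p $ 2) \<le> d"
        using root_index_le[OF simple, of "p $ 1" "p $ 2"] that total_degree_bounds(1)[OF f(2)]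
        by (simp add: X_def)
      ultimately show ?thesis by (simp add: \<kappa>_def)
    qed
    then obtain c where c: "card X \<le> card (\<kappa> -` {c} \<inter> X) * K"
      using pigeonhole_card[of \<kappa> X "{..D} \<times> {..d}"] finX
      by (auto simp: K_def card_cartesian_product)
    define T where "T = \<kappa> -` {c} \<inter> X"
    have T: "finite T" "T \<subseteq> A \<inter> C" using finX by (auto simp: T_def X_def)
    have "K * (m0 + k) < K * card T" using less_le_trans[OF cardX(2) c] by (simp only: T_def mult.commute)
    \<comment> \<open>Exceeding \<open>k\<close> rules out the collinear case; exceeding
      \<open>m0\<close> makes the chain long enough.\<close>
    then have cardT: "m0 + k < card T" by simp
    \<comment> \<open>A zero of \<open>P\<close> between \<open>p\<close> and \<open>q\<close> would
      count for \<open>q\<close> but not for \<open>p\<close>, so their classes would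
      differ.\<close>
    have "poly P x \<noteq> 0" if "p \<in> T" "q \<in> T" "p $ 1 \<le> x" "x \<le> q $ 1" for p q x
    proof
      assume "poly P x = 0"
      moreover have "poly P (p $ 1) \<noteq> 0" "poly P (q $ 1) \<noteq> 0" using that by (auto simp: T_def X_def)
      ultimately have "x \<in> Z" "p $ 1 < x" "x < q $ 1"
        using that by (auto simp: Z_def order.strict_iff_order)
      then have "{z \<in> Z. z < p $ 1} \<subseteq> {z \<in> Z. z < q $ 1}"
        "x \<in> {z \<in> Z. z < q $ 1}" "x \<notin> {z \<in> Z. z < p $ 1}" by auto
      then have "{z \<in> Z. z < p $ 1} \<subset> {z \<in> Z. z < q $ 1}" by blast
      then have "card {z \<in> Z. z < p $ 1} < card {z \<in> Z. z < q $ 1}"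
        using Z(1) by (intro psubset_card_mono) auto
      then show False using that by (auto simp: T_def \<kappa>_def)
    qed
    then have "collinear T \<or> (\<exists>\<sigma> p. convex_chain \<sigma> (card T) p \<and> p ` {..<card T} = T)"
      using T cardT f(3)
      by (intro collinear_or_convex_chain[OF simple P(5), of T "snd c"])
        (auto simp: T_def \<kappa>_def eval2_eq_ev)
    moreover have "\<not> collinear T"
      using card_collinear_less[OF k, of T] T cardT by auto
    ultimately obtain \<sigma> p where chain: "convex_chain \<sigma> (card T) p" "p ` {..<card T} = T" by blast
    have "card A = card (A \<inter> C) + card (A - C)"
      using A by (subst card_Un_disjoint[symmetric]) (auto intro!: arg_cong[of _ _ card])
    also have "\<dots> \<le> 2 * card (A \<inter> C)" using few by simp
    also have "\<dots> \<le> 4 * card X" using cardX by simp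
    also have "\<dots> \<le> 4 * K * card T" using c by (simp add: T_def mult.commute mult.left_commute)
    finally show "\<exists>S. card S = l \<and> mutually_visible A S"
      using m0[OF _ chain(1) A] chain(2) T cardT by auto
  qed simp
qed

end
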